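(* A general polynomial vector $f=(f_1,f_2,f_3)\in \mathrm{Sym}^3\mathbb{C}^3\oplus \mathrm{Sym}^3\mathbb{C}^3\oplus \mathrm{Sym}^4\mathbb{C}^3$ has a unique Waring decomposition of rank $7$ (i.e. with $7$ summands); namely, it is identifiable.
   Context: The ground field is $\mathbb{C}$; $\mathrm{Sym}^a\mathbb{C}^{n+1}$ is the space of homogeneous forms of degree $a$ in $n+1$ variables. "General" means: for all $f$ in some nonempty Zariski open subset of the space. Let $2\le a_1\le\dots\le a_r$ and $f=(f_1,\dots,f_r)$ with $f_j\in \mathrm{Sym}^{a_j}\mathbb{C}^{n+1}$. A Waring decomposition of $f$ with $k$ summands is given by nonzero linear forms $\ell_1,\dots,\ell_k\in\mathbb{C}^{n+1}$ (each considered up to scalar multiples) and scalar vectors $(\lambda_1^j,\dots,\lambda_k^j)\in\mathbb{C}^k\setminus\{0\}$, $j=1,\dots,r$, such that $$f=\sum_{i=1}^k\left(\lambda_i^1\ell_i^{a_1},\dots,\lambda_i^r\ell_i^{a_r}\right).$$ Two Waring decompositions are considered equal if they differ only by the order of the $k$ summands $(\lambda_i^1\ell_i^{a_1},\dots,\lambda_i^r\ell_i^{a_r})$ (rescaling $\ell_i$ and correspondingly the $\lambda_i^j$ does not change the summand). The rank of $f$ is the minimum $k$ for which such a decomposition exists. "Identifiable" means that the decomposition with the stated number of summands is unique. Here $n=2$, $r=3$, $(a_1,a_2,a_3)=(3,3,4)$. *)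

theory Defs
  imports "HOL-Analysis.Analysis" "HOL-Library.Poly_Mapping" "HOL-Library.Multiset"
begin

text \<open>
  A polynomial over the complex numbers in variables indexed by \<open>'v\<close> maps exponent vectors to
  coefficients; the ring operations are those of \<^theory>\<open>HOL-Library.Poly_Mapping\<close>. Forms in
  \<open>n + 1\<close> variables have a finite index type \<open>'v\<close> with \<open>n + 1\<close> elements.
\<close>

type_synonym 'v cpoly = "('v \<Rightarrow>\<^sub>0 nat) \<Rightarrow>\<^sub>0 complex"

definition scale :: "complex \<Rightarrow> 'v cpoly \<Rightarrow> 'v cpoly"
  where "scale c p = Poly_Mapping.single 0 c * p"

definition forms :: "nat \<Rightarrow> ('v::finite) cpoly set"
  where "forms d = {p. \<forall>m \<in> Poly_Mapping.keys p. (\<Sum>v\<in>UNIV. Poly_Mapping.lookup m v) = d}"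

text \<open>The direct sum of the spaces of forms of degree \<open>a $ j\<close>.\<close>

definition poly_vectors :: "nat ^ 'r \<Rightarrow> (('v::finite) cpoly ^ 'r) set"
  where "poly_vectors a = {f. \<forall>j. f $ j \<in> forms (a $ j)}"

definition poly_eval :: "('x \<Rightarrow> complex) \<Rightarrow> 'x cpoly \<Rightarrow> complex"
  where "poly_eval z P = (\<Sum>m \<in> Poly_Mapping.keys P. Poly_Mapping.lookup P m *
           (\<Prod>x \<in> Poly_Mapping.keys m. z x ^ Poly_Mapping.lookup m x))"

text \<open>
  The coordinates on \<^term>\<open>poly_vectors a\<close> are the coefficients of the components. Coordinates
  belonging to monomials of the wrong degree vanish identically on this space, so admitting them
  as variables does not change its polynomial functions.
\<close>

definition coords :: "'v cpoly ^ 'r \<Rightarrow> 'r \<times> ('v \<Rightarrow>\<^sub>0 nat) \<Rightarrow> complex"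
  where "coords f = (\<lambda>(j, m). Poly_Mapping.lookup (f $ j) m)"

definition zariski_closed_in :: "('v cpoly ^ 'r) set \<Rightarrow> ('v cpoly ^ 'r) set \<Rightarrow> bool"
  where "zariski_closed_in V Z \<longleftrightarrow>
           (\<exists>S :: ('r \<times> ('v \<Rightarrow>\<^sub>0 nat)) cpoly set. Z = {f \<in> V. \<forall>P\<in>S. poly_eval (coords f) P = 0})"

definition zariski_open_in :: "('v cpoly ^ 'r) set \<Rightarrow> ('v cpoly ^ 'r) set \<Rightarrow> bool"
  where "zariski_open_in V U \<longleftrightarrow> U \<subseteq> V \<and> zariski_closed_in V (V - U)"

definition holds_for_general :: "('v cpoly ^ 'r) set \<Rightarrow> ('v cpoly ^ 'r \<Rightarrow> bool) \<Rightarrow> bool"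
  where "holds_for_general V Q \<longleftrightarrow> (\<exists>U. zariski_open_in V U \<and> U \<noteq> {} \<and> (\<forall>f\<in>U. Q f))"

definition waring_summand ::
    "nat ^ 'r \<Rightarrow> complex ^ 'r \<Rightarrow> 'v cpoly \<Rightarrow> 'v cpoly ^ 'r"
  where "waring_summand a c l = (\<chi> j. scale (c $ j) (l ^ (a $ j)))"

text \<open>
  Here \<open>l i\<close> is the \<open>i\<close>-th linear form and \<open>c i $ j\<close> the scalar with lower index \<open>i\<close> and upper
  index \<open>j\<close>. The last condition on \<open>c\<close> says that for each \<open>j\<close> the scalar vector in the
  \<open>k\<close>-dimensional space is nonzero.
\<close>

definition is_waring_decomposition ::
    "nat ^ 'r \<Rightarrow> nat \<Rightarrow> ('v::finite) cpoly ^ 'r \<Rightarrow>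
     (nat \<Rightarrow> 'v cpoly) \<Rightarrow> (nat \<Rightarrow> complex ^ 'r) \<Rightarrow> bool"
  where "is_waring_decomposition a k f l c \<longleftrightarrow>
           (\<forall>i<k. l i \<in> forms 1 \<and> l i \<noteq> 0) \<and>
           (\<forall>j. \<exists>i<k. c i $ j \<noteq> 0) \<and>
           f = (\<Sum>i<k. waring_summand a (c i) (l i))"

text \<open>
  Decompositions are identified when they differ only by the order of the summands, hence are
  represented by the multiset of their summands.
\<close>

definition waring_decompositions ::
    "nat ^ 'r \<Rightarrow> nat \<Rightarrow> ('v::finite) cpoly ^ 'r \<Rightarrow> ('v cpoly ^ 'r) multiset set"
  where "waring_decompositions a k f =
           {{# waring_summand a (c i) (l i). i \<in># mset_set {..<k} #} | l c.
              is_waring_decomposition a k f l c}"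

definition identifiable :: "nat ^ 'r \<Rightarrow> nat \<Rightarrow> ('v::finite) cpoly ^ 'r \<Rightarrow> bool"
  where "identifiable a k f \<longleftrightarrow> (\<exists>!D. D \<in> waring_decompositions a k f)"

end

theory Submission
  imports Defs "HOL-Computational_Algebra.Fundamental_Theorem_Algebra"
begin

text \<open>
  Let \<open>Q\<close> be the quotient bundle on the projective plane. A section of \<open>Q(2)\<close> is a triple of quadrics
  \<open>(q\<^sub>0, q\<^sub>1, q\<^sub>2)\<close> modulo linear multiples of \<open>(x, y, z)\<close>; it vanishes where \<open>(q\<^sub>0, q\<^sub>1, q\<^sub>2)\<close> is
  proportional to \<open>(x, y, z)\<close>, that is at the common zeros of three cubics. These sections form a
  space of dimension 15, and by the Chern number \<open>c\<^sub>2(Q(2)) = 7\<close> a general one has seven zeros.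
  The sections whose cubics are apolar to \<open>f\<^sub>1\<close> and \<open>f\<^sub>2\<close>, and whose cubics times linear forms are
  apolar to \<open>f\<^sub>3\<close>, are the solutions of \<open>3 + 3 + 8 = 14\<close> linear equations, so for general \<open>f\<close>
  there is exactly one such section \<open>s\<close> up to scalars.

  Seven points impose at most 14 conditions on sections, so some nonzero section vanishes at the points
  of a given decomposition. It solves the 14 equations, hence is \<open>s\<close>, and the points are the zeros
  of \<open>s\<close>. They are distinct because fewer than seven points would lie on too many sections.
  Conversely, if \<open>s\<close> has seven zeros, then the functionals annihilated by the equations of \<open>s\<close>
  have the right dimension to be spanned by the evaluations at these zeros, which are linearly
  independent. All genericity conditions are polynomial in \<open>f\<close>: the dependence of \<open>s\<close> on \<open>f\<close> by
  Gaussian elimination, the number of zeros of \<open>s\<close> by eliminating \<open>z\<close> from the cubics, which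
  gives a polynomial of degree 7 in \<open>t = y / x\<close>.
\<close>

section \<open>Polynomial functions and linear systems\<close>

definition monomial_eval :: "('x \<Rightarrow> complex) \<Rightarrow> ('x \<Rightarrow>\<^sub>0 nat) \<Rightarrow> complex"
  where "monomial_eval z m = (\<Prod>x \<in> Poly_Mapping.keys m. z x ^ Poly_Mapping.lookup m x)"

lemma monomial_eval_superset:
  assumes "finite A" "Poly_Mapping.keys m \<subseteq> A"
  shows "monomial_eval z m = (\<Prod>x\<in>A. z x ^ Poly_Mapping.lookup m x)"
  unfolding monomial_eval_def
  by (rule prod.mono_neutral_left) (use assms in \<open>auto simp: in_keys_iff\<close>)

lemma monomial_eval_add: "monomial_eval z (m + m') = monomial_eval z m * monomial_eval z m'"
proof -
  let ?A = "Poly_Mapping.keys m \<union> Poly_Mapping.keys m'"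
  have "monomial_eval z (m + m') = (\<Prod>x\<in>?A. z x ^ Poly_Mapping.lookup (m + m') x)"
    by (rule monomial_eval_superset) (auto simp: in_keys_iff lookup_add)
  also have "\<dots> = monomial_eval z m * monomial_eval z m'"
    by (simp add: lookup_add power_add prod.distrib monomial_eval_superset[of ?A])
  finally show ?thesis .
qed

lemma poly_eval_superset:
  assumes "finite A" "Poly_Mapping.keys P \<subseteq> A"
  shows "poly_eval z P = (\<Sum>m\<in>A. Poly_Mapping.lookup P m * monomial_eval z m)"
  unfolding poly_eval_def monomial_eval_def[symmetric]
  by (rule sum.mono_neutral_left) (use assms in \<open>auto simp: in_keys_iff\<close>)

lemma poly_eval_single: "poly_eval z (Poly_Mapping.single m c) = c * monomial_eval z m"
  by (subst poly_eval_superset[of "{m}"]) auto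

lemma poly_eval_add: "poly_eval z (P + Q) = poly_eval z P + poly_eval z Q"
proof -
  let ?A = "Poly_Mapping.keys P \<union> Poly_Mapping.keys Q"
  have "poly_eval z (P + Q) = (\<Sum>m\<in>?A. Poly_Mapping.lookup (P + Q) m * monomial_eval z m)"
    by (rule poly_eval_superset) (auto simp: in_keys_iff lookup_add)
  also have "\<dots> = poly_eval z P + poly_eval z Q"
    by (simp add: lookup_add sum.distrib distrib_right poly_eval_superset[of ?A])
  finally show ?thesis .
qed

lemma poly_eval_sum: "poly_eval z (\<Sum>i\<in>I. P i) = (\<Sum>i\<in>I. poly_eval z (P i))"
  by (induction I rule: infinite_finite_induct) (auto simp: poly_eval_add poly_eval_def[of z 0])

lemma poly_mapping_eq_sum_single:
  "P = (\<Sum>m\<in>Poly_Mapping.keys P. Poly_Mapping.single m (Poly_Mapping.lookup P m))"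
  by (rule poly_mapping_eqI) (auto simp: lookup_sum lookup_single when_def in_keys_iff)

lemma poly_eval_mult: "poly_eval z (P * Q) = poly_eval z P * poly_eval z Q"
proof -
  let ?s = "\<lambda>P m. Poly_Mapping.single m (Poly_Mapping.lookup P m)"
  have "P * Q = (\<Sum>m\<in>Poly_Mapping.keys P. ?s P m) * (\<Sum>m\<in>Poly_Mapping.keys Q. ?s Q m)"
    by (simp flip: poly_mapping_eq_sum_single)
  also have "\<dots> = (\<Sum>m\<in>Poly_Mapping.keys P. \<Sum>m'\<in>Poly_Mapping.keys Q. ?s P m * ?s Q m')"
    by (simp add: sum_product)
  finally have "poly_eval z (P * Q) =
      (\<Sum>m\<in>Poly_Mapping.keys P. \<Sum>m'\<in>Poly_Mapping.keys Q.
         (Poly_Mapping.lookup P m * monomial_eval z m) * (Poly_Mapping.lookup Q m' * monomial_eval z m'))"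
    by (simp add: poly_eval_sum mult_single poly_eval_single monomial_eval_add mult_ac)
  also have "\<dots> = poly_eval z P * poly_eval z Q"
    by (simp add: sum_product poly_eval_def monomial_eval_def)
  finally show ?thesis .
qed

definition polyfun :: "('v cpoly ^ 'r \<Rightarrow> complex) \<Rightarrow> bool"
  where "polyfun g \<longleftrightarrow> (\<exists>P. \<forall>f. g f = poly_eval (coords f) P)"

lemma polyfun_const [intro]: "polyfun (\<lambda>_. c)"
  unfolding polyfun_def
  by (rule exI[of _ "Poly_Mapping.single 0 c"]) (simp add: poly_eval_single monomial_eval_def)

lemma polyfun_coord: "polyfun (\<lambda>f. Poly_Mapping.lookup (f $ j) m)"
  unfolding polyfun_def
  by (rule exI[of _ "Poly_Mapping.single (Poly_Mapping.single (j, m) 1) 1"])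
     (simp add: poly_eval_single monomial_eval_def coords_def)

lemma polyfun_add [intro]: "polyfun g \<Longrightarrow> polyfun h \<Longrightarrow> polyfun (\<lambda>f. g f + h f)"
  unfolding polyfun_def by (metis poly_eval_add)

lemma polyfun_mult [intro]: "polyfun g \<Longrightarrow> polyfun h \<Longrightarrow> polyfun (\<lambda>f. g f * h f)"
  unfolding polyfun_def by (metis poly_eval_mult)

lemma polyfun_uminus [intro]: "polyfun g \<Longrightarrow> polyfun (\<lambda>f. - g f)"
  using polyfun_mult[OF polyfun_const[of "-1"], of g] by simp

lemma polyfun_diff [intro]: "polyfun g \<Longrightarrow> polyfun h \<Longrightarrow> polyfun (\<lambda>f. g f - h f)"
  using polyfun_add[OF _ polyfun_uminus, of g h] by simp

lemma polyfun_sum [intro]: "(\<And>i. i \<in> I \<Longrightarrow> polyfun (g i)) \<Longrightarrow> polyfun (\<lambda>f. \<Sum>i\<in>I. g i f)"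
  by (induction I rule: infinite_finite_induct) auto

text \<open>A principal open set; its nonemptiness is checked later at a single witness.\<close>

lemma zariski_open_in_nonzero:
  assumes "polyfun g"
  shows "zariski_open_in V {f \<in> V. g f \<noteq> 0}"
proof -
  from assms obtain P where P: "\<And>f. g f = poly_eval (coords f) P"
    unfolding polyfun_def by blast
  show ?thesis unfolding zariski_open_in_def zariski_closed_in_def
    by (intro conjI exI[of _ "{P}"]) (auto simp: P)
qed

section \<open>Linear systems with polynomial coefficients, and dimension counts\<close>

text \<open>Cramer's rule by division-free Gaussian elimination. The pivots are chosen nonzero at
  \<open>f0\<close> and stay polynomial in \<open>f\<close>; \<open>\<Delta>\<close> is their
  product, and the right-hand side carries the factor \<open>\<Delta>\<close> in place of a
  division.\<close>

lemma generic_linear_system: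
  fixes a :: "'v cpoly ^ 'r \<Rightarrow> 'i \<Rightarrow> 'j \<Rightarrow> complex"
  assumes "finite J" "finite I" "card I = card J"
    and "\<And>i j. i \<in> I \<Longrightarrow> j \<in> J \<Longrightarrow> polyfun (\<lambda>f. a f i j)"
    and "\<And>i. i \<in> I \<Longrightarrow> polyfun (\<lambda>f. b f i)"
    and "\<And>x. (\<forall>i\<in>I. (\<Sum>j\<in>J. a f0 i j * x j) = 0) \<Longrightarrow> \<forall>j\<in>J. x j = 0"
  shows "\<exists>\<Delta> s. polyfun \<Delta> \<and> (\<forall>j\<in>J. polyfun (\<lambda>f. s f j)) \<and> \<Delta> f0 \<noteq> 0 \<and>
           (\<forall>f. \<forall>i\<in>I. (\<Sum>j\<in>J. a f i j * s f j) = \<Delta> f * b f i) \<and>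
           (\<forall>f. \<Delta> f \<noteq> 0 \<longrightarrow>
             (\<forall>x. (\<forall>i\<in>I. (\<Sum>j\<in>J. a f i j * x j) = 0) \<longrightarrow> (\<forall>j\<in>J. x j = 0)))"
  using assms
proof (induction J arbitrary: I a b rule: finite_induct)
  case empty
  then show ?case by (intro exI[of _ "\<lambda>_. 1"]) auto
next
  case (insert j0 J)
  note pa = insert.prems(3) and pb = insert.prems(4) and inj = insert.prems(5)
  obtain i0 where i0: "i0 \<in> I" and pivot: "a f0 i0 j0 \<noteq> 0"
  proof -
    have "\<exists>i\<in>I. a f0 i j0 \<noteq> 0"
    proof (rule ccontr)
      assume "\<not> ?thesis"
      moreover have "(\<Sum>j\<in>J. a f0 i j * (if j = j0 then 1 else 0)) = 0" for i
        using insert.hyps by (intro sum.neutral) auto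
      ultimately show False
        using inj[of "\<lambda>j. if j = j0 then 1 else 0"] insert.hyps by simp
    qed
    then show ?thesis using that by blast
  qed
  define p where "p f = a f i0 j0" for f
  \<comment> \<open>Cross-multiplying with the pivot clears column \<open>j0\<close> and keeps the
    entries polynomial in \<open>f\<close>.\<close>
  define a' where "a' f i j = p f * a f i j - a f i j0 * a f i0 j" for f i j
  define b' where "b' f i = p f * b f i - a f i j0 * b f i0" for f i
  define I' where "I' = I - {i0}"
  have I: "I = insert i0 I'" "i0 \<notin> I'" "finite I'" using i0 insert.prems(1) by (auto simp: I'_def)
  have pp: "polyfun p" using pa[OF i0, of j0] by (simp add: p_def[abs_def])
  have elim: "(\<Sum>j\<in>J. a' f i j * x j) = p f * (\<Sum>j\<in>J. a f i j * x j) - a f i j0 * (\<Sum>j\<in>J. a f i0 j * x j)"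
    for f i x
    by (simp add: a'_def sum_subtractf sum_distrib_left algebra_simps)
  have "card I' = card J" using insert I by simp
  moreover have "polyfun (\<lambda>f. a' f i j)" if "i \<in> I'" "j \<in> J" for i j
    unfolding a'_def using that I by (intro polyfun_diff polyfun_mult pp pa) auto
  moreover have "polyfun (\<lambda>f. b' f i)" if "i \<in> I'" for i
    unfolding b'_def using that I by (intro polyfun_diff polyfun_mult pp pa pb) auto
  moreover have "\<forall>j\<in>J. x j = 0" if x: "\<forall>i\<in>I'. (\<Sum>j\<in>J. a' f0 i j * x j) = 0" for x
  proof -
    \<comment> \<open>Solving row \<open>i0\<close> for coordinate \<open>j0\<close> extends a
      kernel vector of the reduced system to one of the full system.\<close>
    define y where "y = x(j0 := - (\<Sum>j\<in>J. a f0 i0 j * x j) / p f0)"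
    have y: "(\<Sum>j\<in>J. a f0 i j * y j) = (\<Sum>j\<in>J. a f0 i j * x j)" for i
      using insert.hyps by (intro sum.cong) (auto simp: y_def)
    have "(\<Sum>j\<in>insert j0 J. a f0 i j * y j) = 0" if "i \<in> I" for i
    proof (cases "i = i0")
      case True
      then show ?thesis using insert.hyps pivot by (simp add: y) (simp add: y_def p_def)
    next
      case False
      then have "p f0 * (\<Sum>j\<in>J. a f0 i j * x j) = a f0 i j0 * (\<Sum>j\<in>J. a f0 i0 j * x j)"
        using x that I by (auto simp: elim)
      then show ?thesis using insert.hyps pivot
        by (simp add: y) (simp add: y_def p_def field_simps)
    qed
    then have "\<forall>j\<in>insert j0 J. y j = 0" using inj by blast
    then show ?thesis using insert.hyps by (auto simp: y_def split: if_splits)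
  qed
  ultimately have "\<exists>\<Delta> s. polyfun \<Delta> \<and> (\<forall>j\<in>J. polyfun (\<lambda>f. s f j)) \<and> \<Delta> f0 \<noteq> 0 \<and>
           (\<forall>f. \<forall>i\<in>I'. (\<Sum>j\<in>J. a' f i j * s f j) = \<Delta> f * b' f i) \<and>
           (\<forall>f. \<Delta> f \<noteq> 0 \<longrightarrow>
             (\<forall>x. (\<forall>i\<in>I'. (\<Sum>j\<in>J. a' f i j * x j) = 0) \<longrightarrow> (\<forall>j\<in>J. x j = 0)))"
    using I(3) by (intro insert.IH)
  then obtain \<Delta>' s' where *: "polyfun \<Delta>' \<and> (\<forall>j\<in>J. polyfun (\<lambda>f. s' f j)) \<and> \<Delta>' f0 \<noteq> 0 \<and>
           (\<forall>f. \<forall>i\<in>I'. (\<Sum>j\<in>J. a' f i j * s' f j) = \<Delta>' f * b' f i) \<and>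
           (\<forall>f. \<Delta>' f \<noteq> 0 \<longrightarrow>
             (\<forall>x. (\<forall>i\<in>I'. (\<Sum>j\<in>J. a' f i j * x j) = 0) \<longrightarrow> (\<forall>j\<in>J. x j = 0)))"
    by (elim exE)
  from * have D: "polyfun \<Delta>'" "\<forall>j\<in>J. polyfun (\<lambda>f. s' f j)" "\<Delta>' f0 \<noteq> 0"
    by - (elim conjE, assumption)+
  from * have sol: "\<And>f i. i \<in> I' \<Longrightarrow> (\<Sum>j\<in>J. a' f i j * s' f j) = \<Delta>' f * b' f i"
    by (elim conjE) blast
  have inj': "\<forall>j\<in>J. x j = 0"
    if nz: "\<Delta>' f \<noteq> 0" and ker: "\<forall>i\<in>I'. (\<Sum>j\<in>J. a' f i j * x j) = 0" for f x
  proof -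
    from * have "\<forall>f. \<Delta>' f \<noteq> 0 \<longrightarrow>
        (\<forall>x. (\<forall>i\<in>I'. (\<Sum>j\<in>J. a' f i j * x j) = 0) \<longrightarrow> (\<forall>j\<in>J. x j = 0))"
      by (elim conjE)
    from mp[OF spec[OF this] nz] have
      "\<forall>x. (\<forall>i\<in>I'. (\<Sum>j\<in>J. a' f i j * x j) = 0) \<longrightarrow> (\<forall>j\<in>J. x j = 0)" .
    from mp[OF spec[OF this] ker] show ?thesis .
  qed
  define \<Delta> where "\<Delta> f = p f * \<Delta>' f" for f
  \<comment> \<open>Back substitution with cleared denominators: the reduced solution is multiplied
    by the pivot, and coordinate \<open>j0\<close> is chosen to solve row \<open>i0\<close>.\<close>
  define s where "s f j = (if j = j0 then \<Delta>' f * b f i0 - (\<Sum>j\<in>J. a f i0 j * s' f j) else p f * s' f j)"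
    for f j
  have c1: "polyfun \<Delta>" unfolding \<Delta>_def[abs_def] by (intro polyfun_mult pp D)
  have c2: "polyfun (\<lambda>f. s f j)" if "j \<in> insert j0 J" for j
  proof (cases "j = j0")
    case True
    show ?thesis unfolding s_def using True D i0
      by (auto intro!: polyfun_diff polyfun_mult polyfun_sum pa pb)
  next
    case False
    then show ?thesis unfolding s_def using D that pp by auto
  qed
  have c3: "\<Delta> f0 \<noteq> 0" using pivot D by (simp add: \<Delta>_def p_def)
  have c4: "(\<Sum>j\<in>insert j0 J. a f i j * s f j) = \<Delta> f * b f i" if i: "i \<in> I" for f i
  proof -
    have sJ: "(\<Sum>j\<in>J. a f i j * s f j) = p f * (\<Sum>j\<in>J. a f i j * s' f j)"
      using insert.hyps unfolding sum_distrib_left by (intro sum.cong) (auto simp: s_def)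
    have *: "(\<Sum>j\<in>insert j0 J. a f i j * s f j) =
        a f i j0 * (\<Delta>' f * b f i0 - (\<Sum>j\<in>J. a f i0 j * s' f j)) + p f * (\<Sum>j\<in>J. a f i j * s' f j)"
      using insert.hyps sJ by (simp add: s_def)
    show ?thesis
    proof (cases "i = i0")
      case True
      then show ?thesis unfolding * by (simp add: \<Delta>_def p_def algebra_simps)
    next
      case False
      then have "p f * (\<Sum>j\<in>J. a f i j * s' f j) - a f i j0 * (\<Sum>j\<in>J. a f i0 j * s' f j) = \<Delta>' f * b' f i"
        using sol[of i f] i I by (simp add: elim)
      then show ?thesis unfolding * by (simp add: \<Delta>_def b'_def algebra_simps)
    qed
  qed
  have c5: "\<forall>j\<in>insert j0 J. x j = 0"
    if "\<Delta> f \<noteq> 0" and x: "\<forall>i\<in>I. (\<Sum>j\<in>insert j0 J. a f i j * x j) = 0" for f x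
  proof -
    have nz: "p f \<noteq> 0" "\<Delta>' f \<noteq> 0" using that by (auto simp: \<Delta>_def)
    have e: "(\<Sum>j\<in>J. a f i j * x j) = - a f i j0 * x j0" if "i \<in> I" for i
      using x that insert.hyps by (simp add: add_eq_0_iff)
    have "(\<Sum>j\<in>J. a' f i j * x j) = 0" if "i \<in> I'" for i
      using that I unfolding elim by (simp add: e p_def)
    then have J: "\<forall>j\<in>J. x j = 0" using inj' nz by blast
    then have "p f * x j0 = 0" using e[OF i0] by (simp add: p_def)
    then show ?thesis using J nz by simp
  qed
  show ?case
    by (intro exI[of _ \<Delta>] exI[of _ s] conjI ballI allI impI,
        rule c1, erule c2, rule c3, erule c4, (rule bspec[OF c5], assumption+))
qed

text \<open>Induction on the unknowns: if the column of \<open>j0\<close> vanishes, its unit vector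
  is a solution; otherwise a pivot row removes one unknown together with one equation.\<close>

lemma underdetermined_system:
  fixes a :: "'i \<Rightarrow> 'j \<Rightarrow> complex"
  assumes "finite J" "finite I" "card I < card J"
  shows "\<exists>x. (\<exists>j\<in>J. x j \<noteq> 0) \<and> (\<forall>i\<in>I. (\<Sum>j\<in>J. a i j * x j) = 0)"
  using assms
proof (induction J arbitrary: I a rule: finite_induct)
  case empty
  then show ?case by simp
next
  case (insert j0 J)
  show ?case
  proof (cases "\<exists>i\<in>I. a i j0 \<noteq> 0")
    case False
    have "(\<Sum>j\<in>J. a i j * (if j = j0 then 1 else 0)) = 0" for i
      using insert.hyps by (intro sum.neutral) auto
    then show ?thesis using False insert.hyps
      by (intro exI[of _ "\<lambda>j. if j = j0 then 1 else 0"]) auto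
  next
    case True
    then obtain i0 where i0: "i0 \<in> I" "a i0 j0 \<noteq> 0" by blast
    have "card (I - {i0}) < card J" using insert.prems i0 insert.hyps card_gt_0_iff[of I] by (auto simp: card_Diff_singleton)
    then obtain x where x: "\<exists>j\<in>J. x j \<noteq> 0"
      "\<forall>i\<in>I - {i0}. (\<Sum>j\<in>J. (a i0 j0 * a i j - a i j0 * a i0 j) * x j) = 0"
      using insert.IH[of "I - {i0}" "\<lambda>i j. a i0 j0 * a i j - a i j0 * a i0 j"] insert.prems by auto
    define y where "y = x(j0 := - (\<Sum>j\<in>J. a i0 j * x j) / a i0 j0)"
    have y: "(\<Sum>j\<in>J. a i j * y j) = (\<Sum>j\<in>J. a i j * x j)" for i
      using insert.hyps by (intro sum.cong) (auto simp: y_def)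
    have "(\<Sum>j\<in>insert j0 J. a i j * y j) = 0" if "i \<in> I" for i
    proof (cases "i = i0")
      case True
      then show ?thesis using insert.hyps i0 by (simp add: y) (simp add: y_def)
    next
      case False
      then have "(\<Sum>j\<in>J. (a i0 j0 * a i j - a i j0 * a i0 j) * x j) = 0"
        using x that by blast
      then have "a i0 j0 * (\<Sum>j\<in>J. a i j * x j) = a i j0 * (\<Sum>j\<in>J. a i0 j * x j)"
        by (simp add: sum_subtractf sum_distrib_left algebra_simps)
      then show ?thesis using insert.hyps i0
        by (simp add: y) (simp add: y_def field_simps)
    qed
    moreover have "\<exists>j\<in>insert j0 J. y j \<noteq> 0" using x(1) insert.hyps by (auto simp: y_def)
    ultimately show ?thesis by blast
  qed
qed

text \<open>The \<open>card X + 1\<close> vectors \<open>u\<close>, the conjugates of the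
  \<open>g i\<close>, and the \<open>e j\<close> are linearly dependent. Pairing with the
  \<open>g i\<close> shows that the conjugate part of the relation has Hermitian norm zero, so the
  relation involves only \<open>u\<close> and the \<open>e j\<close>.\<close>

lemma annihilator_spanned:
  fixes g :: "'i \<Rightarrow> 'x \<Rightarrow> complex" and e :: "'j \<Rightarrow> 'x \<Rightarrow> complex"
  assumes fin: "finite X" "finite G" "finite E" and card: "card G + card E = card X"
    and indep_g: "\<And>c. (\<forall>x\<in>X. (\<Sum>i\<in>G. c i * g i x) = 0) \<Longrightarrow> \<forall>i\<in>G. c i = 0"
    and indep_e: "\<And>c. (\<forall>x\<in>X. (\<Sum>j\<in>E. c j * e j x) = 0) \<Longrightarrow> \<forall>j\<in>E. c j = 0"
    and ortho: "\<And>i j. i \<in> G \<Longrightarrow> j \<in> E \<Longrightarrow> (\<Sum>x\<in>X. g i x * e j x) = 0"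
    and u: "\<And>i. i \<in> G \<Longrightarrow> (\<Sum>x\<in>X. g i x * u x) = 0"
  shows "\<exists>c. \<forall>x\<in>X. u x = (\<Sum>j\<in>E. c j * e j x)"
proof -
  define m where "m x k = (case k of None \<Rightarrow> u x | Some (Inl i) \<Rightarrow> cnj (g i x) | Some (Inr j) \<Rightarrow> e j x)"
    for x k
  let ?K = "insert None (Some ` (G <+> E))"
  have cK: "card ?K = Suc (card X)" using fin card
    by (simp add: card_image card_Plus)
  obtain y where y: "\<exists>k\<in>?K. y k \<noteq> 0" "\<And>x. x \<in> X \<Longrightarrow> (\<Sum>k\<in>?K. m x k * y k) = 0"
    using underdetermined_system[of ?K X m] fin cK by auto
  define gb where "gb x = (\<Sum>i\<in>G. y (Some (Inl i)) * cnj (g i x))" for x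
  define eb where "eb x = (\<Sum>j\<in>E. y (Some (Inr j)) * e j x)" for x
  have rel: "y None * u x + gb x + eb x = 0" if "x \<in> X" for x
  proof -
    have "(\<Sum>k\<in>?K. m x k * y k) = y None * u x + (\<Sum>k\<in>G <+> E. m x (Some k) * y (Some k))"
      using fin by (simp add: sum.reindex m_def mult.commute)
    also have "(\<Sum>k\<in>G <+> E. m x (Some k) * y (Some k)) = gb x + eb x"
      using fin by (simp add: sum.Plus m_def gb_def eb_def mult.commute)
    finally show ?thesis using y(2)[OF that] by (simp add: add.assoc)
  qed
  have g0: "(\<Sum>x\<in>X. g i x * gb x) = 0" if i: "i \<in> G" for i
  proof -
    have "(\<Sum>x\<in>X. g i x * eb x) = (\<Sum>j\<in>E. y (Some (Inr j)) * (\<Sum>x\<in>X. g i x * e j x))"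
      unfolding eb_def sum_distrib_left by (subst sum.swap) (simp add: mult_ac)
    also have "\<dots> = 0" using ortho i by (intro sum.neutral) auto
    finally have "(\<Sum>x\<in>X. g i x * eb x) = 0" .
    moreover have "(\<Sum>x\<in>X. g i x * (y None * u x)) = 0"
    proof -
      have "(\<Sum>x\<in>X. g i x * (y None * u x)) = y None * (\<Sum>x\<in>X. g i x * u x)"
        by (simp add: sum_distrib_left mult_ac)
      then show ?thesis using u i by simp
    qed
    moreover have "(\<Sum>x\<in>X. g i x * (y None * u x + gb x + eb x)) = 0"
      using rel by (intro sum.neutral) auto
    ultimately show ?thesis by (simp add: distrib_left sum.distrib)
  qed
  have cg: "cnj (gb x) = (\<Sum>i\<in>G. cnj (y (Some (Inl i))) * g i x)" for x by (simp add: gb_def)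
  \<comment> \<open>\<open>gb\<close> lies in the span of the conjugates of the \<open>g i\<close>
    and is annihilated by the \<open>g i\<close>, hence is orthogonal to itself.\<close>
  have "(\<Sum>x\<in>X. cnj (gb x) * gb x) = (\<Sum>i\<in>G. cnj (y (Some (Inl i))) * (\<Sum>x\<in>X. g i x * gb x))"
    unfolding cg
    by (simp only: sum_distrib_right[of _ _ "gb _"] sum_distrib_left) (subst sum.swap, simp add: mult_ac)
  also have "\<dots> = 0" using g0 by simp
  finally have "(\<Sum>x\<in>X. complex_of_real ((cmod (gb x))\<^sup>2)) = 0"
    by (simp only: complex_norm_square mult.commute)
  then have "(\<Sum>x\<in>X. (cmod (gb x))\<^sup>2) = 0"
    by (metis of_real_eq_0_iff of_real_sum)
  then have gb: "gb x = 0" if "x \<in> X" for x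
    using that fin by (simp add: sum_nonneg_eq_0_iff)
  have yg: "y (Some (Inl i)) = 0" if "i \<in> G" for i
  proof -
    have "(\<Sum>i\<in>G. cnj (y (Some (Inl i))) * g i x) = cnj (gb x)" for x by (simp add: gb_def)
    then have "\<forall>i\<in>G. cnj (y (Some (Inl i))) = 0" using gb by (intro indep_g) auto
    then show ?thesis using that by simp
  qed
  have "y None \<noteq> 0"
  proof
    assume 0: "y None = 0"
    then have "\<forall>j\<in>E. y (Some (Inr j)) = 0"
      using rel gb by (intro indep_e) (auto simp: eb_def)
    then show False using y(1) 0 yg by auto
  qed
  have "u x = (\<Sum>j\<in>E. (- y (Some (Inr j)) / y None) * e j x)" if "x \<in> X" for x
  proof -
    have "(\<Sum>j\<in>E. (- y (Some (Inr j)) / y None) * e j x) = - eb x / y None"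
      unfolding eb_def by (simp add: sum_divide_distrib sum_negf)
    also have "\<dots> = u x"
    proof -
      have "y None * u x + eb x = 0" using rel[OF that] gb[OF that] by simp
      then have "- eb x = y None * u x" by (metis add_eq_0_iff2 minus_minus)
      then show ?thesis using \<open>y None \<noteq> 0\<close> by simp
    qed
    finally show ?thesis by simp
  qed
  then show ?thesis by (intro exI[of _ "\<lambda>j. - y (Some (Inr j)) / y None"] ballI)
qed

section \<open>Elimination\<close>

definition polyfun_coeffs :: "('v cpoly ^ 'r \<Rightarrow> complex poly) \<Rightarrow> bool"
  where "polyfun_coeffs F \<longleftrightarrow> (\<forall>k. polyfun (\<lambda>f. coeff (F f) k))"

lemma polyfun_coeffs_pCons:
  "polyfun g \<Longrightarrow> polyfun_coeffs F \<Longrightarrow> polyfun_coeffs (\<lambda>f. pCons (g f) (F f))"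
  unfolding polyfun_coeffs_def
  by (intro allI, rename_tac k, case_tac k) auto

lemma polyfun_coeffs_const: "polyfun_coeffs (\<lambda>_. p)"
  unfolding polyfun_coeffs_def by auto

lemma polyfun_coeffs_add:
  "polyfun_coeffs F \<Longrightarrow> polyfun_coeffs G \<Longrightarrow> polyfun_coeffs (\<lambda>f. F f + G f)"
  unfolding polyfun_coeffs_def by auto

lemma polyfun_coeffs_diff:
  "polyfun_coeffs F \<Longrightarrow> polyfun_coeffs G \<Longrightarrow> polyfun_coeffs (\<lambda>f. F f - G f)"
  unfolding polyfun_coeffs_def by auto

lemma polyfun_coeffs_mult:
  "polyfun_coeffs F \<Longrightarrow> polyfun_coeffs G \<Longrightarrow> polyfun_coeffs (\<lambda>f. F f * G f)"
  unfolding polyfun_coeffs_def coeff_mult by (intro allI polyfun_sum polyfun_mult) auto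

lemma polyfun_coeffs_pderiv: "polyfun_coeffs F \<Longrightarrow> polyfun_coeffs (\<lambda>f. pderiv (F f))"
  unfolding polyfun_coeffs_def coeff_pderiv by auto

lemmas polyfun_coeffs_intros = polyfun_coeffs_pCons polyfun_coeffs_const polyfun_coeffs_add
  polyfun_coeffs_diff polyfun_coeffs_mult polyfun_coeffs_pderiv

lemma coeff_sum_monom_mult:
  "coeff ((\<Sum>j<n. monom (x j) j) * F) i = (\<Sum>j<n. coeff (monom 1 j * F) i * (x j :: complex))"
proof -
  have "monom (x j) j * F = smult (x j) (monom 1 j * F)" for j
    by (simp add: smult_monom flip: mult_smult_left)
  then show ?thesis unfolding sum_distrib_right coeff_sum by (simp only: coeff_smult mult.commute)
qed

lemma degree_sum_monom_less: "0 < n \<Longrightarrow> degree (\<Sum>j<n. monom (x j :: complex) j) < n"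
  by (rule degree_sum_less) (auto intro: le_less_trans[OF degree_monom_le])

text \<open>The Sylvester matrix of \<open>F f\<close> and \<open>G f\<close> is invertible at
  \<open>f0\<close>: a kernel vector gives \<open>P * F + Q * G = 0\<close> with
  \<open>degree Q < m\<close>, and the Bezout identity makes \<open>F f0\<close>, of degree exactly
  \<open>m\<close>, divide \<open>Q\<close>. Solving for the constant 1 yields
  \<open>P * F + Q * G = \<Delta>\<close>, which excludes a common root wherever
  \<open>\<Delta>\<close> is nonzero.\<close>

lemma generic_coprime:
  assumes F: "polyfun_coeffs F" "\<And>f. degree (F f) \<le> m" and G: "polyfun_coeffs G" "\<And>f. degree (G f) \<le> n"
    and m: "degree (F f0) = m" "0 < m" and bezout: "u * F f0 + v * G f0 = 1"
  shows "\<exists>\<Delta>. polyfun \<Delta> \<and> \<Delta> f0 \<noteq> 0 \<and>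
           (\<forall>f t. \<Delta> f \<noteq> 0 \<longrightarrow> poly (F f) t = 0 \<longrightarrow> poly (G f) t \<noteq> 0)"
proof -
  define a where "a f i j = (if j < n then coeff (monom 1 j * F f) i else coeff (monom 1 (j - n) * G f) i)"
    for f i j
  define P where "P x = (\<Sum>j<n. monom (x j) j)" for x :: "nat \<Rightarrow> complex"
  define Q where "Q x = (\<Sum>j<m. monom (x (n + j)) j)" for x :: "nat \<Rightarrow> complex"
  have split: "(\<Sum>j<m + n. h j) = (\<Sum>j<n. h j) + (\<Sum>j<m. h (n + j))" for h :: "nat \<Rightarrow> complex"
    by (induction m) (auto simp: add_ac)
  have lin: "(\<Sum>j<m + n. a f i j * x j) = coeff (P x * F f + Q x * G f) i" for f i x
    unfolding split P_def Q_def coeff_add coeff_sum_monom_mult by (simp add: a_def)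
  have "\<exists>\<Delta> s. polyfun \<Delta> \<and> (\<forall>j\<in>{..<m + n}. polyfun (\<lambda>f. s f j)) \<and> \<Delta> f0 \<noteq> 0 \<and>
          (\<forall>f. \<forall>i\<in>{..<m + n}. (\<Sum>j<m + n. a f i j * s f j) = \<Delta> f * (if i = 0 then 1 else 0)) \<and>
          (\<forall>f. \<Delta> f \<noteq> 0 \<longrightarrow>
             (\<forall>x. (\<forall>i\<in>{..<m + n}. (\<Sum>j<m + n. a f i j * x j) = 0) \<longrightarrow> (\<forall>j\<in>{..<m + n}. x j = 0)))"
  proof (rule generic_linear_system)
    fix i j
    have "polyfun_coeffs (\<lambda>f. monom 1 j * F f)" "polyfun_coeffs (\<lambda>f. monom 1 (j - n) * G f)"
      using F G by (auto intro: polyfun_coeffs_intros)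
    then show "polyfun (\<lambda>f. a f i j)" unfolding a_def polyfun_coeffs_def by (cases "j < n") simp_all
  next
    fix x assume x: "\<forall>i\<in>{..<m + n}. (\<Sum>j<m + n. a f0 i j * x j) = 0"
    have dP: "P x = 0 \<or> degree (P x) < n"
      using degree_sum_monom_less[of n x] by (cases "n = 0") (auto simp: P_def)
    have dQ: "degree (Q x) < m" using degree_sum_monom_less[of m] m by (simp add: Q_def)
    have "degree (P x * F f0) < m + n"
      using dP degree_mult_le[of "P x" "F f0"] m by auto
    moreover have "degree (Q x * G f0) < m + n"
      using dQ degree_mult_le[of "Q x" "G f0"] G(2)[of f0] by linarith
    ultimately have "degree (P x * F f0 + Q x * G f0) < m + n" by (rule degree_add_less)
    then have eq: "P x * F f0 + Q x * G f0 = 0"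
      using x unfolding lin by (intro poly_eqI) (metis coeff_0 coeff_eq_0 lessThan_iff linorder_not_less order_less_le_trans)
    then have "F f0 dvd Q x * G f0" by (metis add_eq_0_iff dvd_minus_iff dvd_triv_right)
    moreover have "Q x = (Q x * u) * F f0 + v * (Q x * G f0)"
      using arg_cong[OF bezout, of "\<lambda>p. Q x * p"] by (simp add: algebra_simps)
    ultimately have "F f0 dvd Q x" by (metis dvd_add dvd_mult dvd_triv_right)
    then have Q0: "Q x = 0" using dQ m dvd_imp_degree_le by fastforce
    moreover have "F f0 \<noteq> 0" using m by auto
    ultimately have P0: "P x = 0" using eq by simp
    have "coeff (P x) j = x j" if "j < n" for j
      using that by (simp add: P_def coeff_sum)
    moreover have "coeff (Q x) j = x (n + j)" if "j < m" for j
      using that by (simp add: Q_def coeff_sum)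
    ultimately show "\<forall>j\<in>{..<m + n}. x j = 0"
      using P0 Q0 by (metis add.commute add_diff_inverse_nat coeff_0 lessThan_iff less_diff_conv2 linorder_not_less)
  qed auto
  then obtain \<Delta> s where D: "polyfun \<Delta>" "\<Delta> f0 \<noteq> 0"
    and sol: "\<forall>f. \<forall>i\<in>{..<m + n}. (\<Sum>j<m + n. a f i j * s f j) = \<Delta> f * (if i = 0 then 1 else 0)"
    by (elim exE conjE) (rule that)
  have "poly (G f) t \<noteq> 0" if nz: "\<Delta> f \<noteq> 0" and root: "poly (F f) t = 0" for f t
  proof
    assume G0: "poly (G f) t = 0"
    let ?H = "P (s f) * F f + Q (s f) * G f"
    have dP: "P (s f) = 0 \<or> degree (P (s f)) < n"
      using degree_sum_monom_less[of n "s f"] by (cases "n = 0") (auto simp: P_def)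
    have dQ: "degree (Q (s f)) < m" using degree_sum_monom_less[of m] m by (simp add: Q_def)
    have "degree (P (s f) * F f) < m + n"
      using dP degree_mult_le[of "P (s f)" "F f"] F(2)[of f] m by auto
    moreover have "degree (Q (s f) * G f) < m + n"
      using dQ degree_mult_le[of "Q (s f)" "G f"] G(2)[of f] by linarith
    ultimately have deg: "degree ?H < m + n" by (rule degree_add_less)
    have "?H = [:\<Delta> f:]"
    proof (rule poly_eqI)
      fix i
      show "coeff ?H i = coeff [:\<Delta> f:] i"
      proof (cases "i < m + n")
        case True
        then have "coeff ?H i = \<Delta> f * (if i = 0 then 1 else 0)"
          using sol lin[of f i "s f"] by auto
        then show ?thesis by (simp add: coeff_pCons split: nat.split)
      next
        case False
        then have "coeff ?H i = 0" "i \<noteq> 0" using deg m(2) by (auto intro!: coeff_eq_0 simp del: coeff_add)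
        then show ?thesis by (simp add: coeff_pCons split: nat.split)
      qed
    qed
    moreover have "poly ?H t = 0" using root G0 by simp
    ultimately show False using nz by simp
  qed
  then show ?thesis using D by (intro exI[of _ \<Delta>]) auto
qed

lemma card_roots_squarefree:
  fixes p :: "complex poly"
  assumes "p \<noteq> 0" "\<And>t. poly p t = 0 \<Longrightarrow> poly (pderiv p) t \<noteq> 0"
  shows "card {t. poly p t = 0} = degree p"
proof -
  have fin: "finite {t. poly p t = 0}" using assms by (simp add: poly_roots_finite)
  have "rsquarefree p" using assms by (auto simp: rsquarefree_roots)
  then have eq: "smult (lead_coeff p) (\<Prod>z|poly p z = 0. [:-z, 1:]) = p"
    by (rule complex_poly_decompose_rsquarefree)
  have "degree p = degree (\<Prod>z|poly p z = 0. [:-z, 1:])"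
    by (subst eq[symmetric]) (use assms in simp)
  also have "\<dots> = card {t. poly p t = 0}"
    by (simp add: degree_prod_eq_sum_degree)
  finally show ?thesis by simp
qed

text \<open>
  The resultant of \<open>A\<^sub>2 z\<^sup>2 + A\<^sub>1 z + A\<^sub>0\<close> and \<open>B\<^sub>3 z\<^sup>3 + B\<^sub>2 z\<^sup>2 + B\<^sub>1 z + B\<^sub>0\<close>, and the
  coefficients of their first subresultant \<open>S\<^sub>1 z + S\<^sub>0\<close>.
\<close>

definition res23 :: "'a::comm_ring_1 \<Rightarrow> 'a \<Rightarrow> 'a \<Rightarrow> 'a \<Rightarrow> 'a \<Rightarrow> 'a \<Rightarrow> 'a \<Rightarrow> 'a"
  where "res23 A2 A1 A0 B3 B2 B1 B0 =
    B3*B3*A0*A0*A0 - B3*B2*A0*A0*A1 + B3*B1*A0*A1*A1 - 2*(B3*B1*A0*A0*A2) - B3*B0*A1*A1*A1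
    + 3*(B3*B0*A1*A0*A2) + B2*B2*A0*A0*A2 - B2*B1*A1*A0*A2 + B2*B0*A1*A1*A2 - 2*(B2*B0*A0*A2*A2)
    + B1*B1*A0*A2*A2 - B1*B0*A1*A2*A2 + B0*B0*A2*A2*A2"

definition subres1 :: "'a::comm_ring_1 \<Rightarrow> 'a \<Rightarrow> 'a \<Rightarrow> 'a \<Rightarrow> 'a \<Rightarrow> 'a \<Rightarrow> 'a"
  where "subres1 A2 A1 A0 B3 B2 B1 = A2*A2*B1 - A2*A1*B2 + A1*A1*B3 - A0*A2*B3"

definition subres0 :: "'a::comm_ring_1 \<Rightarrow> 'a \<Rightarrow> 'a \<Rightarrow> 'a \<Rightarrow> 'a \<Rightarrow> 'a \<Rightarrow> 'a"
  where "subres0 A2 A1 A0 B3 B2 B0 = A2*A2*B0 - A2*A0*B2 + A1*A0*B3"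

text \<open>Both equations can be solved for their constant coefficients; substituting these makes
  the resultant vanish identically.\<close>

lemma res23_common_root:
  fixes A2 A1 A0 B3 B2 B1 B0 z :: complex
  assumes "A2*z^2 + A1*z + A0 = 0" "B3*z^3 + B2*z^2 + B1*z + B0 = 0"
  shows "res23 A2 A1 A0 B3 B2 B1 B0 = 0"
proof -
  have A0: "A0 = - (A2*z^2 + A1*z)" and B0: "B0 = - (B3*z^3 + B2*z^2 + B1*z)"
    using assms by (simp_all only: add_eq_0_iff)
  show ?thesis unfolding res23_def A0 B0 by algebra
qed

text \<open>The subresultant is the pseudo-remainder of the cubic by the quadratic polynomial, hence
  a combination of both and zero at a common root.\<close>

lemma common_root_unique:
  fixes A2 A1 A0 B3 B2 B1 B0 z :: complex
  assumes "A2*z^2 + A1*z + A0 = 0" "B3*z^3 + B2*z^2 + B1*z + B0 = 0"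
    and "subres1 A2 A1 A0 B3 B2 B1 \<noteq> 0"
  shows "z = - subres0 A2 A1 A0 B3 B2 B0 / subres1 A2 A1 A0 B3 B2 B1"
proof -
  have "subres1 A2 A1 A0 B3 B2 B1 * z + subres0 A2 A1 A0 B3 B2 B0 =
      A2^2 * (B3*z^3 + B2*z^2 + B1*z + B0) - (A2*B3*z + A2*B2 - A1*B3) * (A2*z^2 + A1*z + A0)"
    unfolding subres1_def subres0_def by algebra
  then have "subres1 A2 A1 A0 B3 B2 B1 * z + subres0 A2 A1 A0 B3 B2 B0 = 0" using assms by simp
  then have "z * subres1 A2 A1 A0 B3 B2 B1 = - subres0 A2 A1 A0 B3 B2 B0"
    by (simp add: eq_neg_iff_add_eq_0 mult.commute)
  then show ?thesis using assms(3) by (metis nonzero_eq_divide_eq)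
qed

text \<open>Substituting the root of the subresultant into either polynomial and clearing
  denominators gives a multiple of the resultant.\<close>

lemma common_root_exists:
  fixes A2 A1 A0 B3 B2 B1 B0 :: complex
  assumes R: "res23 A2 A1 A0 B3 B2 B1 B0 = 0" and S: "subres1 A2 A1 A0 B3 B2 B1 \<noteq> 0"
  defines "z \<equiv> - subres0 A2 A1 A0 B3 B2 B0 / subres1 A2 A1 A0 B3 B2 B1"
  shows "A2*z^2 + A1*z + A0 = 0" "B3*z^3 + B2*z^2 + B1*z + B0 = 0"
proof -
  let ?S1 = "subres1 A2 A1 A0 B3 B2 B1" and ?S0 = "subres0 A2 A1 A0 B3 B2 B0"
  have z: "?S1 * z = - ?S0" using S by (simp add: z_def)
  have "A2 * ?S0^2 - A1 * ?S0 * ?S1 + A0 * ?S1^2 = A2^2 * res23 A2 A1 A0 B3 B2 B1 B0"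
    unfolding subres1_def subres0_def res23_def by algebra
  moreover have "A2 * ?S0^2 - A1 * ?S0 * ?S1 + A0 * ?S1^2 = ?S1^2 * (A2*z^2 + A1*z + A0)"
    using z by algebra
  ultimately show "A2*z^2 + A1*z + A0 = 0" using R S by simp
  have "- (B3 * ?S0^3) + B2 * ?S0^2 * ?S1 - B1 * ?S0 * ?S1^2 + B0 * ?S1^3 =
      res23 A2 A1 A0 B3 B2 B1 B0 * ((A2*B2 - A1*B3) * ?S1 - A2*B3*?S0)"
    unfolding subres1_def subres0_def res23_def by algebra
  moreover have "- (B3 * ?S0^3) + B2 * ?S0^2 * ?S1 - B1 * ?S0 * ?S1^2 + B0 * ?S1^3 =
      ?S1^3 * (B3*z^3 + B2*z^2 + B1*z + B0)"
    using z by algebra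
  ultimately show "B3*z^3 + B2*z^2 + B1*z + B0 = 0" using R S by simp
qed

lemma poly_res23:
  "poly (res23 A2 A1 A0 B3 B2 B1 B0) t =
   res23 (poly A2 t) (poly A1 t) (poly A0 t) (poly B3 t) (poly B2 t) (poly B1 t) (poly B0 (t::complex))"
  by (simp add: res23_def)

lemma poly_subres1:
  "poly (subres1 A2 A1 A0 B3 B2 B1) t =
   subres1 (poly A2 t) (poly A1 t) (poly A0 t) (poly B3 t) (poly B2 t) (poly B1 (t::complex))"
  by (simp add: subres1_def)

text \<open>The new cubic polynomial is \<open>t * B + z * A\<close>. Adding a multiple of
  \<open>A\<close> does not change the resultant, which is homogeneous of degree 2 in the
  coefficients of \<open>B\<close>.\<close>

lemma res23_combine:
  fixes t :: "'a::comm_ring_1"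
  shows "res23 A2 A1 A0 (t*B3 + A2) (t*B2 + A1) (t*B1 + A0) (t*B0) = t*t * res23 A2 A1 A0 B3 B2 B1 B0"
  unfolding res23_def by (simp add: algebra_simps)

section \<open>Degree bounds for resultants with polynomial entries\<close>

text \<open>The coefficient \<open>c\<close> may be zero, so, unlike the degree and the leading
  coefficient, this notion passes through sums whose top terms cancel.\<close>

definition top_coeff :: "nat \<Rightarrow> 'a::comm_ring_1 poly \<Rightarrow> 'a \<Rightarrow> bool"
  where "top_coeff n p c \<longleftrightarrow> degree p \<le> n \<and> coeff p n = c"

lemma top_coeff_mult: "top_coeff m p a \<Longrightarrow> top_coeff n q b \<Longrightarrow> top_coeff (m + n) (p * q) (a * b)"
proof -
  assume "top_coeff m p a" "top_coeff n q b"
  then have d: "degree p \<le> m" "degree q \<le> n" and c: "coeff p m = a" "coeff q n = b"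
    by (auto simp: top_coeff_def)
  have "coeff (p * q) (m + n) = (\<Sum>i\<le>m + n. coeff p i * coeff q (m + n - i))"
    by (simp add: coeff_mult)
  also have "\<dots> = (\<Sum>i\<in>{m}. coeff p i * coeff q (m + n - i))"
  proof (rule sum.mono_neutral_right)
    show "\<forall>i\<in>{..m + n} - {m}. coeff p i * coeff q (m + n - i) = 0"
    proof
      fix i assume "i \<in> {..m + n} - {m}"
      then have "m < i \<or> n < m + n - i" by auto
      then show "coeff p i * coeff q (m + n - i) = 0" using d by (auto simp: coeff_eq_0)
    qed
  qed auto
  finally show ?thesis
    using d c degree_mult_le[of p q] by (auto simp: top_coeff_def intro: order_trans)
qed

lemma top_coeff_add: "top_coeff n p a \<Longrightarrow> top_coeff n q b \<Longrightarrow> top_coeff n (p + q) (a + b)"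
  by (auto simp: top_coeff_def degree_add_le)

lemma top_coeff_diff: "top_coeff n p a \<Longrightarrow> top_coeff n q b \<Longrightarrow> top_coeff n (p - q) (a - b)"
  by (auto simp: top_coeff_def degree_diff_le)

lemma top_coeff_numeral_mult: "top_coeff n p a \<Longrightarrow> top_coeff n (numeral k * p) (numeral k * a)"
  using top_coeff_mult[of 0 "numeral k" "numeral k" n p a]
  by (simp add: top_coeff_def numeral_poly)

lemma top_coeff_mult5:
  "top_coeff m1 p1 a1 \<Longrightarrow> top_coeff m2 p2 a2 \<Longrightarrow> top_coeff m3 p3 a3 \<Longrightarrow> top_coeff m4 p4 a4 \<Longrightarrow>
   top_coeff m5 p5 a5 \<Longrightarrow> m1 + m2 + m3 + m4 + m5 = n \<Longrightarrow>
   top_coeff n (p1 * p2 * p3 * p4 * p5) (a1 * a2 * a3 * a4 * a5)"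
  by (blast intro: top_coeff_mult)

text \<open>The resultant is isobaric: with the degree bounds as weights, every monomial has weight
  9.\<close>

lemma top_coeff_res23:
  assumes "top_coeff 1 A2 a2" "top_coeff 2 A1 a1" "top_coeff 3 A0 a0"
    "top_coeff 0 B3 b3" "top_coeff 1 B2 b2" "top_coeff 2 B1 b1" "top_coeff 3 B0 b0"
  shows "top_coeff 9 (res23 A2 A1 A0 B3 B2 B1 B0) (res23 a2 a1 a0 b3 b2 b1 b0)"
  unfolding res23_def
  by (intro top_coeff_add top_coeff_diff top_coeff_numeral_mult)
     (rule top_coeff_mult5, (rule assms)+, simp)+

section \<open>Invertibility of the Sylvester matrix\<close>

text \<open>Cramer's rule as a certificate: the five equations form the Sylvester matrix,
  \<open>res23\<close> is its determinant, and the factors of the equations are the entries of its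
  adjugate.\<close>

lemma sylvester_injective:
  fixes A2 A1 A0 B3 B2 B1 B0 h0 h1 h2 h3 h4 :: complex
  assumes "res23 A2 A1 A0 B3 B2 B1 B0 \<noteq> 0"
    and eqs: "A0*h0 + A1*h1 + A2*h2 = 0" "A0*h1 + A1*h2 + A2*h3 = 0" "A0*h2 + A1*h3 + A2*h4 = 0"
      "B0*h0 + B1*h1 + B2*h2 + B3*h3 = 0" "B0*h1 + B1*h2 + B2*h3 + B3*h4 = 0"
  shows "h0 = 0" "h1 = 0" "h2 = 0" "h3 = 0" "h4 = 0"
proof -
  have "res23 A2 A1 A0 B3 B2 B1 B0 * h0 =
      (A0*A0*B3*B3 - A0*A1*B2*B3 + A0*A2*B2*B2 - 2*A0*A2*B1*B3 + A1*A1*B1*B3 - A1*A2*B1*B2 + A1*A2*B0*B3 + A2*A2*B1*B1 - A2*A2*B0*B2) * (A0*h0 + A1*h1 + A2*h2) +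
      (-A0*A1*B3*B3 + A1*A1*B2*B3 - A1*A2*B2*B2 + A2*A2*B1*B2 - A2*A2*B0*B3) * (A0*h1 + A1*h2 + A2*h3) +
      (A1*A1*B3*B3 - A1*A2*B2*B3 - A0*A2*B3*B3 + A2*A2*B1*B3) * (A0*h2 + A1*h3 + A2*h4) +
      (-A1*A1*A1*B3 + A1*A1*A2*B2 + 2*A0*A1*A2*B3 - A1*A2*A2*B1 - A0*A2*A2*B2 + A2*A2*A2*B0) * (B0*h0 + B1*h1 + B2*h2 + B3*h3) +
      (-A1*A1*A2*B3 + A1*A2*A2*B2 + A0*A2*A2*B3 - A2*A2*A2*B1) * (B0*h1 + B1*h2 + B2*h3 + B3*h4)"
    unfolding res23_def by algebra
  then show "h0 = 0" using assms by simp
  have "res23 A2 A1 A0 B3 B2 B1 B0 * h1 =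
      (-A1*A1*B0*B3 + A1*A2*B0*B2 + A0*A2*B0*B3 - A2*A2*B0*B1) * (A0*h0 + A1*h1 + A2*h2) +
      (A0*A0*B3*B3 - A0*A1*B2*B3 + A0*A2*B2*B2 - A0*A2*B1*B3 + A1*A2*B0*B3 - A2*A2*B0*B2) * (A0*h1 + A1*h2 + A2*h3) +
      (-A0*A1*B3*B3 + A0*A2*B2*B3 - A2*A2*B0*B3) * (A0*h2 + A1*h3 + A2*h4) +
      (A0*A1*A1*B3 - A0*A1*A2*B2 - A0*A0*A2*B3 + A0*A2*A2*B1) * (B0*h0 + B1*h1 + B2*h2 + B3*h3) +
      (A0*A1*A2*B3 - A0*A2*A2*B2 + A2*A2*A2*B0) * (B0*h1 + B1*h2 + B2*h3 + B3*h4)"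
    unfolding res23_def by algebra
  then show "h1 = 0" using assms by simp
  have "res23 A2 A1 A0 B3 B2 B1 B0 * h2 =
      (A0*A1*B0*B3 - A0*A2*B0*B2 + A2*A2*B0*B0) * (A0*h0 + A1*h1 + A2*h2) +
      (A0*A1*B1*B3 - A0*A2*B1*B2 + A0*A2*B0*B3 - A1*A1*B0*B3 + A1*A2*B0*B2) * (A0*h1 + A1*h2 + A2*h3) +
      (A0*A0*B3*B3 - A0*A2*B1*B3 + A1*A2*B0*B3) * (A0*h2 + A1*h3 + A2*h4) +
      (-A0*A0*A1*B3 + A0*A0*A2*B2 - A0*A2*A2*B0) * (B0*h0 + B1*h1 + B2*h2 + B3*h3) +
      (-A0*A0*A2*B3 + A0*A2*A2*B1 - A1*A2*A2*B0) * (B0*h1 + B1*h2 + B2*h3 + B3*h4)"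
    unfolding res23_def by algebra
  then show "h2 = 0" using assms by simp
  have "res23 A2 A1 A0 B3 B2 B1 B0 * h3 =
      (-A0*A0*B0*B3 + A0*A2*B0*B1 - A1*A2*B0*B0) * (A0*h0 + A1*h1 + A2*h2) +
      (-A0*A0*B1*B3 + A0*A2*B1*B1 - A0*A2*B0*B2 + A0*A1*B0*B3 - A1*A2*B0*B1 + A2*A2*B0*B0) * (A0*h1 + A1*h2 + A2*h3) +
      (-A0*A0*B2*B3 + A0*A1*B1*B3 - A1*A1*B0*B3 + A0*A2*B0*B3) * (A0*h2 + A1*h3 + A2*h4) +
      (A0*A0*A0*B3 - A0*A0*A2*B1 + A0*A1*A2*B0) * (B0*h0 + B1*h1 + B2*h2 + B3*h3) +
      (A0*A0*A2*B2 - A0*A1*A2*B1 + A1*A1*A2*B0 - A0*A2*A2*B0) * (B0*h1 + B1*h2 + B2*h3 + B3*h4)"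
    unfolding res23_def by algebra
  then show "h3 = 0" using assms by simp
  have "res23 A2 A1 A0 B3 B2 B1 B0 * h4 =
      (A0*A0*B0*B2 - A0*A1*B0*B1 + A1*A1*B0*B0 - A0*A2*B0*B0) * (A0*h0 + A1*h1 + A2*h2) +
      (A0*A0*B1*B2 - A0*A0*B0*B3 - A0*A1*B1*B1 + A1*A1*B0*B1 - A1*A2*B0*B0) * (A0*h1 + A1*h2 + A2*h3) +
      (A0*A0*B2*B2 - A0*A0*B1*B3 - A0*A1*B1*B2 + A0*A1*B0*B3 + A0*A2*B1*B1 - 2*A0*A2*B0*B2 + A1*A1*B0*B2 - A1*A2*B0*B1 + A2*A2*B0*B0) * (A0*h2 + A1*h3 + A2*h4) +
      (-A0*A0*A0*B2 + A0*A0*A1*B1 - A0*A1*A1*B0 + A0*A0*A2*B0) * (B0*h0 + B1*h1 + B2*h2 + B3*h3) +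
      (A0*A0*A0*B3 - A0*A0*A1*B2 + A0*A1*A1*B1 - A0*A0*A2*B1 - A1*A1*A1*B0 + 2*A0*A1*A2*B0) * (B0*h1 + B1*h2 + B2*h3 + B3*h4)"
    unfolding res23_def by algebra
  then show "h4 = 0" using assms by simp
qed

text \<open>The equations are the coefficients of
  \<open>(m0 + m1 z + m2 z^2) * A + (m3 + m4 z) * B\<close>; the factors are the entries of the
  transposed adjugate.\<close>

lemma sylvester_injective_transposed:
  fixes A2 A1 A0 B3 B2 B1 B0 m0 m1 m2 m3 m4 :: complex
  assumes "res23 A2 A1 A0 B3 B2 B1 B0 \<noteq> 0"
    and eqs: "A0*m0 + B0*m3 = 0"
      "A1*m0 + A0*m1 + B1*m3 + B0*m4 = 0"
      "A2*m0 + A1*m1 + A0*m2 + B2*m3 + B1*m4 = 0"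
      "A2*m1 + A1*m2 + B3*m3 + B2*m4 = 0"
      "A2*m2 + B3*m4 = 0"
  shows "m0 = 0" "m1 = 0" "m2 = 0" "m3 = 0" "m4 = 0"
proof -
  have "res23 A2 A1 A0 B3 B2 B1 B0 * m0 =
      (A0*A0*B3*B3 - A0*A1*B2*B3 + A0*A2*B2*B2 - 2*A0*A2*B1*B3 + A1*A1*B1*B3 - A1*A2*B1*B2 + A1*A2*B0*B3 + A2*A2*B1*B1 - A2*A2*B0*B2) * (A0*m0 + B0*m3) +
      (-A1*A1*B0*B3 + A1*A2*B0*B2 + A0*A2*B0*B3 - A2*A2*B0*B1) * (A1*m0 + A0*m1 + B1*m3 + B0*m4) +
      (A0*A1*B0*B3 - A0*A2*B0*B2 + A2*A2*B0*B0) * (A2*m0 + A1*m1 + A0*m2 + B2*m3 + B1*m4) +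
      (-A0*A0*B0*B3 + A0*A2*B0*B1 - A1*A2*B0*B0) * (A2*m1 + A1*m2 + B3*m3 + B2*m4) +
      (A0*A0*B0*B2 - A0*A1*B0*B1 + A1*A1*B0*B0 - A0*A2*B0*B0) * (A2*m2 + B3*m4)"
    unfolding res23_def by algebra
  then show "m0 = 0" using assms by simp
  have "res23 A2 A1 A0 B3 B2 B1 B0 * m1 =
      (-A0*A1*B3*B3 + A1*A1*B2*B3 - A1*A2*B2*B2 + A2*A2*B1*B2 - A2*A2*B0*B3) * (A0*m0 + B0*m3) +
      (A0*A0*B3*B3 - A0*A1*B2*B3 + A0*A2*B2*B2 - A0*A2*B1*B3 + A1*A2*B0*B3 - A2*A2*B0*B2) * (A1*m0 + A0*m1 + B1*m3 + B0*m4) +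
      (A0*A1*B1*B3 - A0*A2*B1*B2 + A0*A2*B0*B3 - A1*A1*B0*B3 + A1*A2*B0*B2) * (A2*m0 + A1*m1 + A0*m2 + B2*m3 + B1*m4) +
      (-A0*A0*B1*B3 + A0*A2*B1*B1 - A0*A2*B0*B2 + A0*A1*B0*B3 - A1*A2*B0*B1 + A2*A2*B0*B0) * (A2*m1 + A1*m2 + B3*m3 + B2*m4) +
      (A0*A0*B1*B2 - A0*A0*B0*B3 - A0*A1*B1*B1 + A1*A1*B0*B1 - A1*A2*B0*B0) * (A2*m2 + B3*m4)"
    unfolding res23_def by algebra
  then show "m1 = 0" using assms by simp
  have "res23 A2 A1 A0 B3 B2 B1 B0 * m2 =
      (A1*A1*B3*B3 - A1*A2*B2*B3 - A0*A2*B3*B3 + A2*A2*B1*B3) * (A0*m0 + B0*m3) +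
      (-A0*A1*B3*B3 + A0*A2*B2*B3 - A2*A2*B0*B3) * (A1*m0 + A0*m1 + B1*m3 + B0*m4) +
      (A0*A0*B3*B3 - A0*A2*B1*B3 + A1*A2*B0*B3) * (A2*m0 + A1*m1 + A0*m2 + B2*m3 + B1*m4) +
      (-A0*A0*B2*B3 + A0*A1*B1*B3 - A1*A1*B0*B3 + A0*A2*B0*B3) * (A2*m1 + A1*m2 + B3*m3 + B2*m4) +
      (A0*A0*B2*B2 - A0*A0*B1*B3 - A0*A1*B1*B2 + A0*A1*B0*B3 + A0*A2*B1*B1 - 2*A0*A2*B0*B2 + A1*A1*B0*B2 - A1*A2*B0*B1 + A2*A2*B0*B0) * (A2*m2 + B3*m4)"
    unfolding res23_def by algebra
  then show "m2 = 0" using assms by simp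
  have "res23 A2 A1 A0 B3 B2 B1 B0 * m3 =
      (-A1*A1*A1*B3 + A1*A1*A2*B2 + 2*A0*A1*A2*B3 - A1*A2*A2*B1 - A0*A2*A2*B2 + A2*A2*A2*B0) * (A0*m0 + B0*m3) +
      (A0*A1*A1*B3 - A0*A1*A2*B2 - A0*A0*A2*B3 + A0*A2*A2*B1) * (A1*m0 + A0*m1 + B1*m3 + B0*m4) +
      (-A0*A0*A1*B3 + A0*A0*A2*B2 - A0*A2*A2*B0) * (A2*m0 + A1*m1 + A0*m2 + B2*m3 + B1*m4) +
      (A0*A0*A0*B3 - A0*A0*A2*B1 + A0*A1*A2*B0) * (A2*m1 + A1*m2 + B3*m3 + B2*m4) +
      (-A0*A0*A0*B2 + A0*A0*A1*B1 - A0*A1*A1*B0 + A0*A0*A2*B0) * (A2*m2 + B3*m4)"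
    unfolding res23_def by algebra
  then show "m3 = 0" using assms by simp
  have "res23 A2 A1 A0 B3 B2 B1 B0 * m4 =
      (-A1*A1*A2*B3 + A1*A2*A2*B2 + A0*A2*A2*B3 - A2*A2*A2*B1) * (A0*m0 + B0*m3) +
      (A0*A1*A2*B3 - A0*A2*A2*B2 + A2*A2*A2*B0) * (A1*m0 + A0*m1 + B1*m3 + B0*m4) +
      (-A0*A0*A2*B3 + A0*A2*A2*B1 - A1*A2*A2*B0) * (A2*m0 + A1*m1 + A0*m2 + B2*m3 + B1*m4) +
      (A0*A0*A2*B2 - A0*A1*A2*B1 + A1*A1*A2*B0 - A0*A2*A2*B0) * (A2*m1 + A1*m2 + B3*m3 + B2*m4) +
      (A0*A0*A0*B3 - A0*A0*A1*B2 + A0*A1*A1*B1 - A0*A0*A2*B1 - A1*A1*A1*B0 + 2*A0*A1*A2*B0) * (A2*m2 + B3*m4)"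
    unfolding res23_def by algebra
  then show "m4 = 0" using assms by simp
qed

section \<open>Sections and their zeros\<close>

text \<open>
  A section is a triple of quadrics \<open>(q\<^sub>0, q\<^sub>1, q\<^sub>2)\<close> modulo linear multiples of \<open>(x, y, z)\<close>, which allows
  to remove from \<open>q\<^sub>2\<close> the monomials divisible by \<open>z\<close>. The coordinates \<open>s 0, \<dots>, s 14\<close> are the
  coefficients of \<open>x\<^sup>2, xy, xz, y\<^sup>2, yz, z\<^sup>2\<close> in \<open>q\<^sub>0\<close> and in \<open>q\<^sub>1\<close>, and those of \<open>x\<^sup>2, xy, y\<^sup>2\<close> in \<open>q\<^sub>2\<close>.
  A functional \<open>\<phi>\<close> on polynomials is given by its values on the monomials \<open>x\<^sup>i y\<^sup>j z\<^sup>k\<close>, and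
  \<open>minor m s \<phi> i j k\<close> is its value on \<open>x\<^sup>i y\<^sup>j z\<^sup>k\<close> times the \<open>m\<close>-th of the cubics
  \<open>y q\<^sub>2 - z q\<^sub>1\<close>, \<open>z q\<^sub>0 - x q\<^sub>2\<close>, \<open>x q\<^sub>1 - y q\<^sub>0\<close>.
\<close>

type_synonym functional = "nat \<times> nat \<times> nat \<Rightarrow> complex"

definition contract0 :: "(nat \<Rightarrow> complex) \<Rightarrow> functional \<Rightarrow> nat \<Rightarrow> nat \<Rightarrow> nat \<Rightarrow> complex"
  where "contract0 s \<phi> i j k = s 0 * \<phi> (i+2, j, k) + s 1 * \<phi> (i+1, j+1, k) + s 2 * \<phi> (i+1, j, k+1)
    + s 3 * \<phi> (i, j+2, k) + s 4 * \<phi> (i, j+1, k+1) + s 5 * \<phi> (i, j, k+2)"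

definition contract1 :: "(nat \<Rightarrow> complex) \<Rightarrow> functional \<Rightarrow> nat \<Rightarrow> nat \<Rightarrow> nat \<Rightarrow> complex"
  where "contract1 s \<phi> i j k = s 6 * \<phi> (i+2, j, k) + s 7 * \<phi> (i+1, j+1, k) + s 8 * \<phi> (i+1, j, k+1)
    + s 9 * \<phi> (i, j+2, k) + s 10 * \<phi> (i, j+1, k+1) + s 11 * \<phi> (i, j, k+2)"

definition contract2 :: "(nat \<Rightarrow> complex) \<Rightarrow> functional \<Rightarrow> nat \<Rightarrow> nat \<Rightarrow> nat \<Rightarrow> complex"
  where "contract2 s \<phi> i j k = s 12 * \<phi> (i+2, j, k) + s 13 * \<phi> (i+1, j+1, k) + s 14 * \<phi> (i, j+2, k)"

definition minor :: "nat \<Rightarrow> (nat \<Rightarrow> complex) \<Rightarrow> functional \<Rightarrow> nat \<Rightarrow> nat \<Rightarrow> nat \<Rightarrow> complex"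
  where "minor m s \<phi> i j k =
    (if m = 0 then contract2 s \<phi> i (j+1) k - contract1 s \<phi> i j (k+1)
     else if m = 1 then contract0 s \<phi> i j (k+1) - contract2 s \<phi> (i+1) j k
     else contract1 s \<phi> (i+1) j k - contract0 s \<phi> i (j+1) k)"

lemmas minor_defs = minor_def contract0_def contract1_def contract2_def

definition eval_at :: "complex \<times> complex \<times> complex \<Rightarrow> functional"
  where "eval_at p = (\<lambda>(i, j, k). fst p ^ i * fst (snd p) ^ j * snd (snd p) ^ k)"

text \<open>The origin is always a zero in this sense, so points are assumed nonzero where it
  matters.\<close>

definition zero_of :: "(nat \<Rightarrow> complex) \<Rightarrow> complex \<times> complex \<times> complex \<Rightarrow> bool"
  where "zero_of s p \<longleftrightarrow> (\<forall>m<3. minor m s (eval_at p) 0 0 0 = 0)"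

definition basis_section :: "nat \<Rightarrow> nat \<Rightarrow> complex"
  where "basis_section j i = (if i = j then 1 else 0)"

definition exponents :: "nat \<Rightarrow> (nat \<times> nat \<times> nat) set"
  where "exponents d = {(i, j, k). i + j + k = d}"

definition basis_functional :: "nat \<times> nat \<times> nat \<Rightarrow> functional"
  where "basis_functional \<alpha> \<beta> = (if \<beta> = \<alpha> then 1 else 0)"

lemma less_3_cases: "(m::nat) < 3 \<Longrightarrow> m = 0 \<or> m = 1 \<or> m = 2"
  by auto

lemma all_less_3: "(\<forall>m<3. P m) \<longleftrightarrow> P 0 \<and> P 1 \<and> P (2::nat)"
  using less_3_cases by (auto simp: numeral_eq_Suc)

lemma minor_sum_functional:
  "minor m s (\<lambda>\<beta>. \<Sum>a\<in>A. c a * \<phi> a \<beta>) i j k = (\<Sum>a\<in>A. c a * minor m s (\<phi> a) i j k)"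
proof -
  have "contract0 s (\<lambda>\<beta>. \<Sum>a\<in>A. c a * \<phi> a \<beta>) i j k = (\<Sum>a\<in>A. c a * contract0 s (\<phi> a) i j k)"
    "contract1 s (\<lambda>\<beta>. \<Sum>a\<in>A. c a * \<phi> a \<beta>) i j k = (\<Sum>a\<in>A. c a * contract1 s (\<phi> a) i j k)"
    "contract2 s (\<lambda>\<beta>. \<Sum>a\<in>A. c a * \<phi> a \<beta>) i j k = (\<Sum>a\<in>A. c a * contract2 s (\<phi> a) i j k)"
    for i j k
    by (simp_all add: contract0_def contract1_def contract2_def sum_distrib_left sum.distrib distrib_left mult_ac)
  then show ?thesis by (simp add: minor_def sum_subtractf right_diff_distrib)
qed

lemma minor_cong:
  assumes "\<And>\<alpha>. \<alpha> \<in> exponents (i + j + k + 3) \<Longrightarrow> \<phi> \<alpha> = \<psi> \<alpha>"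
  shows "minor m s \<phi> i j k = minor m s \<psi> i j k"
  unfolding minor_defs using assms by (simp add: exponents_def)

lemma finite_exponents [simp]: "finite (exponents d)"
proof (rule finite_subset)
  show "exponents d \<subseteq> {..d} \<times> {..d} \<times> {..d}" by (auto simp: exponents_def)
qed auto

lemma minor_expand:
  assumes "d = i + j + k + 3"
  shows "minor m s \<phi> i j k = (\<Sum>\<alpha>\<in>exponents d. minor m s (basis_functional \<alpha>) i j k * \<phi> \<alpha>)"
proof -
  have "minor m s \<phi> i j k = minor m s (\<lambda>\<beta>. \<Sum>\<alpha>\<in>exponents d. \<phi> \<alpha> * basis_functional \<alpha> \<beta>) i j k"
    by (rule minor_cong) (simp add: assms basis_functional_def mult_delta_right)
  then show ?thesis by (simp add: minor_sum_functional mult.commute)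
qed

lemma sum_less_15:
  "(\<Sum>a<15. h a) = h 0 + h 1 + h 2 + h 3 + h 4 + h 5 + h 6 + h 7 + h 8 + h 9 + h 10 + h 11 + h 12 + h 13
    + h (14::nat)"
  by (simp add: lessThan_nat_numeral lessThan_Suc add_ac)

lemma minor_expand_section:
  "minor m s \<phi> i j k = (\<Sum>a<15. minor m (basis_section a) \<phi> i j k * s a)"
  by (cases "m = 0"; cases "m = 1")
     (simp_all add: sum_less_15 minor_defs basis_section_def algebra_simps)

lemma minor_section_cong:
  assumes "\<And>a. a < 15 \<Longrightarrow> s a = s' a"
  shows "minor m s \<phi> i j k = minor m s' \<phi> i j k"
  unfolding minor_expand_section[of m s] minor_expand_section[of m s'] using assms by simp

lemma minor_scale_section: "minor m (\<lambda>a. c * s a) \<phi> i j k = c * minor m s \<phi> i j k"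
  by (simp add: minor_defs algebra_simps)

lemma minor_diff_section:
  "minor m (\<lambda>a. s a - s' a) \<phi> i j k = minor m s \<phi> i j k - minor m s' \<phi> i j k"
  by (simp add: minor_defs algebra_simps)

text \<open>Evaluation at a point is multiplicative, so at a zero of the section it annihilates all
  multiples of the cubics.\<close>

lemma minor_eval_at:
  "minor m s (eval_at (x, y, z)) i j k = x ^ i * y ^ j * z ^ k * minor m s (eval_at (x, y, z)) 0 0 0"
  by (simp add: minor_defs eval_at_def algebra_simps power_add)

lemma minor_eval_at_zero: "zero_of s p \<Longrightarrow> m < 3 \<Longrightarrow> minor m s (eval_at p) i j k = 0"
  using minor_eval_at[of m s "fst p" "fst (snd p)" "snd (snd p)" i j k] by (simp add: zero_of_def)

text \<open>The Koszul relation: \<open>(x, y, z)\<close> is orthogonal to its cross product with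
  \<open>(q\<^sub>0, q\<^sub>1, q\<^sub>2)\<close>.\<close>

lemma minor_syzygy:
  "minor 0 s \<phi> (i+1) j k + minor 1 s \<phi> i (j+1) k + minor 2 s \<phi> i j (k+1) = 0"
  by (simp add: minor_defs algebra_simps)

lemma eval_at_scale:
  "eval_at (c * x, c * y, c * z) (i, j, k) = c ^ (i + j + k) * eval_at (x, y, z) (i, j, k)"
  by (simp add: eval_at_def power_add power_mult_distrib)

lemma zero_of_scale: "c \<noteq> 0 \<Longrightarrow> zero_of s (c * x, c * y, c * z) \<longleftrightarrow> zero_of s (x, y, z)"
proof -
  assume c: "c \<noteq> 0"
  have "minor m s (eval_at (c * x, c * y, c * z)) 0 0 0 = c ^ 3 * minor m s (eval_at (x, y, z)) 0 0 0" for m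
    by (simp add: minor_defs eval_at_scale algebra_simps power2_eq_square power3_eq_cube)
  then show ?thesis using c by (simp add: zero_of_def)
qed

text \<open>By the Koszul relation a nonzero point imposes only two linear conditions on the 15
  coordinates; \<open>Z\<close> adds the vanishing of selected coordinates.\<close>

lemma section_vanishing_at:
  assumes fin: "finite P" "finite Z" and nz: "(0, 0, 0) \<notin> P" and card: "2 * card P + card Z < 15"
    and Z: "Z \<subseteq> {..<15}"
  shows "\<exists>s. (\<exists>a<15. s a \<noteq> 0) \<and> (\<forall>p\<in>P. zero_of s p) \<and> (\<forall>a\<in>Z. s a = 0)"
proof -
  \<comment> \<open>Selects the two minors other than one that the Koszul relation multiplies by a
    nonzero coordinate of the point.\<close>
  define sel where "sel p b = (if fst p \<noteq> 0 then (if b then 1 else (2::nat)) else if fst (snd p) \<noteq> 0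
    then (if b then 0 else 2) else (if b then 0 else 1))" for p :: "complex \<times> complex \<times> complex" and b :: bool
  define M where "M r a = (case r of Inl (p, b) \<Rightarrow> minor (sel p b) (basis_section a) (eval_at p) 0 0 0
    | Inr a' \<Rightarrow> basis_section a' a)" for r a
  have "card (P \<times> (UNIV::bool set) <+> Z) < card {..<15::nat}"
    using card fin by (simp add: card_Plus card_cartesian_product)
  then obtain s where s: "\<exists>a<15. s a \<noteq> 0"
    "\<And>r. r \<in> P \<times> (UNIV::bool set) <+> Z \<Longrightarrow> (\<Sum>a<15. M r a * s a) = 0"
    using underdetermined_system[of "{..<15}" "P \<times> (UNIV::bool set) <+> Z" M] fin by auto
  have "zero_of s p" if p: "p \<in> P" for p
  proof -
    obtain x y z where xyz: "p = (x, y, z)" by (cases p)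
    have sel: "minor (sel p b) s (eval_at p) 0 0 0 = 0" for b
      using s(2)[of "Inl (p, b)", OF InlI] p by (simp add: M_def flip: minor_expand_section)
    have syz: "x * minor 0 s (eval_at p) 0 0 0 + y * minor 1 s (eval_at p) 0 0 0
        + z * minor 2 s (eval_at p) 0 0 0 = 0"
      using minor_syzygy[of s "eval_at p" 0 0 0] unfolding xyz
      by (simp add: minor_eval_at[of _ _ _ _ _ "Suc 0"] minor_eval_at[of _ _ _ _ _ _ "Suc 0"]
          minor_eval_at[of _ _ _ _ _ _ _ "Suc 0"])
    have "x \<noteq> 0 \<or> y \<noteq> 0 \<or> z \<noteq> 0" using p nz xyz by auto
    then show ?thesis
      using sel[of True] sel[of False] syz
      unfolding zero_of_def all_less_3 sel_def xyz by (auto split: if_splits)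
  qed
  moreover have "s a = 0" if "a \<in> Z" for a
  proof -
    have "(\<Sum>b<15. basis_section a b * s b) = (\<Sum>b\<in>{a}. basis_section a b * s b)"
      by (rule sum.mono_neutral_right) (use Z that in \<open>auto simp: basis_section_def\<close>)
    then show ?thesis using s(2)[of "Inr a", OF InrI] that by (simp add: M_def) (simp add: basis_section_def)
  qed
  ultimately show ?thesis using s(1) by blast
qed

section \<open>The line at infinity \<open>x = 0\<close>\<close>

text \<open>On \<open>x = 0\<close> the cubics become \<open>y q\<^sub>2 - z q\<^sub>1\<close>,
  \<open>z q\<^sub>0\<close> and \<open>- y q\<^sub>0\<close>; this is the resultant of the binary
  forms \<open>q\<^sub>0\<close> and \<open>z q\<^sub>1 - y q\<^sub>2\<close>.\<close>

definition res_infinity :: "(nat \<Rightarrow> complex) \<Rightarrow> complex"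
  where "res_infinity s = res23 (s 5) (s 4) (s 3) (s 11) (s 10) (s 9) (- s 14)"

text \<open>At such a zero other than the origin both binary forms vanish: either
  \<open>z / y\<close> is a common root, or \<open>y = 0\<close> and the leading coefficients
  \<open>s 5\<close> and \<open>s 11\<close> are zero. In both cases the resultant vanishes.\<close>

lemma zero_of_at_infinity:
  assumes r: "res_infinity s \<noteq> 0" and z: "zero_of s (0, y, z)"
  shows "y = 0 \<and> z = 0"
proof -
  let ?k = "s 3 * y^2 + s 4 * y * z + s 5 * z^2"
  have "minor 0 s (eval_at (0, y, z)) 0 0 0 = s 14 * y^3 - z * (s 9 * y^2 + s 10 * y * z + s 11 * z^2)"
    "minor 1 s (eval_at (0, y, z)) 0 0 0 = z * ?k" "minor 2 s (eval_at (0, y, z)) 0 0 0 = - (y * ?k)"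
    by (simp_all add: minor_defs eval_at_def power2_eq_square power3_eq_cube algebra_simps)
  then have eqs: "s 14 * y^3 - z * (s 9 * y^2 + s 10 * y * z + s 11 * z^2) = 0" "z * ?k = 0" "y * ?k = 0"
    using z unfolding zero_of_def all_less_3 by simp_all
  show ?thesis
  proof (cases "y = 0")
    case True
    have "z = 0"
    proof (rule ccontr)
      assume "z \<noteq> 0"
      then have "s 5 = 0" "s 11 = 0" using eqs True by auto
      then show False using r by (simp add: res_infinity_def res23_def)
    qed
    then show ?thesis using True by simp
  next
    case False
    define w where "w = z / y"
    have zw: "z = w * y" using False by (simp add: w_def)
    have "y^2 * (s 5 * w^2 + s 4 * w + s 3) = ?k"
      unfolding zw by algebra
    then have 1: "s 5 * w^2 + s 4 * w + s 3 = 0" using eqs(3) False by auto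
    have "y^3 * (s 11 * w^3 + s 10 * w^2 + s 9 * w + - s 14) =
        - (s 14 * y^3 - z * (s 9 * y^2 + s 10 * y * z + s 11 * z^2))"
      unfolding zw by algebra
    then have "s 11 * w^3 + s 10 * w^2 + s 9 * w + - s 14 = 0" using eqs(1) False by auto
    then have "res_infinity s = 0" unfolding res_infinity_def by (rule res23_common_root[OF 1])
    then show ?thesis using r by simp
  qed
qed

text \<open>
  Modulo the ideal of the three cubics every form of degree at least 4 is divisible by \<open>x\<close>, since
  the Sylvester matrix of their restrictions to \<open>x = 0\<close> is invertible.
\<close>

lemma functional_vanishes:
  assumes r: "res_infinity s \<noteq> 0"
    and kills: "\<And>m i j k. m < 3 \<Longrightarrow> minor m s \<phi> i j k = 0"
    and shift: "\<And>i j k. \<phi> (i+1, j, k) = \<phi> (i, j, k)"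
    and cubics: "\<And>\<alpha>. \<alpha> \<in> exponents 3 \<Longrightarrow> \<phi> \<alpha> = 0"
  shows "3 \<le> d \<Longrightarrow> \<alpha> \<in> exponents d \<Longrightarrow> \<phi> \<alpha> = 0"
proof (induction d arbitrary: \<alpha> rule: nat_induct_at_least[of 3])
  case base
  then show ?case by (rule cubics)
next
  case (Suc d)
  have x: "\<phi> (i+1, j, k) = 0" if "i + j + k = d" for i j k
    using shift Suc.IH[of "(i, j, k)"] that by (simp add: exponents_def)
  have binary: "\<phi> (0, J, K) = 0" if "J + K = d + 1" for J K
  proof -
    \<comment> \<open>Since \<open>d \<ge> 3\<close>, the monomial \<open>y^J z^K\<close> is among
      five consecutive monomials in \<open>y\<close> and \<open>z\<close> of degree
      \<open>d + 1\<close>.\<close>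
    obtain j k a where jk: "J = j + (4 - a)" "K = k + a" "a \<le> 4" "j + k + 4 = d + 1"
    proof (cases "K \<le> 4")
      case True
      then show ?thesis using that[of "J - (4 - K)" K 0] \<open>J + K = d + 1\<close> Suc.hyps by auto
    next
      case False
      then show ?thesis using that[of J 4 "K - 4"] \<open>J + K = d + 1\<close> by auto
    qed
    define h where "h b = \<phi> (0, j + (4 - b), k + b)" for b
    have x0: "\<phi> (Suc i, j', k') = 0" if "i + j' + k' = d" for i j' k' using x that by simp
    have m1: "minor 1 s \<phi> 0 j' k' = 0" "minor 2 s \<phi> 0 j' k' = 0" "minor 0 s \<phi> 0 j' k' = 0" for j' k'
      using kills by simp_all
    \<comment> \<open>Modulo \<open>x\<close> and up to the factor \<open>y^j z^k\<close>, the
      products of \<open>q\<^sub>0\<close> with \<open>y^2\<close>, \<open>y z\<close>,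
      \<open>z^2\<close> and of the binary cubic with \<open>y\<close>, \<open>z\<close> give the
      five rows of the Sylvester matrix.\<close>
    have "minor 2 s \<phi> 0 (j+1) k = - (s 3 * h 0 + s 4 * h 1 + s 5 * h 2)"
      using jk by (simp add: minor_defs h_def x0 numeral_eq_Suc)
    then have "s 3 * h 0 + s 4 * h 1 + s 5 * h 2 = - minor 2 s \<phi> 0 (j+1) k" by (simp only: minus_minus)
    then have 1: "s 3 * h 0 + s 4 * h 1 + s 5 * h 2 = 0" by (simp only: m1 minus_zero)
    have "minor 2 s \<phi> 0 j (k+1) = - (s 3 * h 1 + s 4 * h 2 + s 5 * h 3)"
      using jk by (simp add: minor_defs h_def x0 numeral_eq_Suc)
    then have "s 3 * h 1 + s 4 * h 2 + s 5 * h 3 = - minor 2 s \<phi> 0 j (k+1)" by (simp only: minus_minus)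
    then have 2: "s 3 * h 1 + s 4 * h 2 + s 5 * h 3 = 0" by (simp only: m1 minus_zero)
    have "minor 1 s \<phi> 0 j (k+1) = (s 3 * h 2 + s 4 * h 3 + s 5 * h 4)"
      using jk by (simp add: minor_defs h_def x0 numeral_eq_Suc)
    then have 3: "s 3 * h 2 + s 4 * h 3 + s 5 * h 4 = 0" by (simp only: m1)
    have "minor 0 s \<phi> 0 (j+1) k = - (- s 14 * h 0 + s 9 * h 1 + s 10 * h 2 + s 11 * h 3)"
      using jk by (simp add: minor_defs h_def x0 numeral_eq_Suc)
    then have "- s 14 * h 0 + s 9 * h 1 + s 10 * h 2 + s 11 * h 3 = - minor 0 s \<phi> 0 (j+1) k" by (simp only: minus_minus)
    then have 4: "- s 14 * h 0 + s 9 * h 1 + s 10 * h 2 + s 11 * h 3 = 0" by (simp only: m1 minus_zero)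
    have "minor 0 s \<phi> 0 j (k+1) = - (- s 14 * h 1 + s 9 * h 2 + s 10 * h 3 + s 11 * h 4)"
      using jk by (simp add: minor_defs h_def x0 numeral_eq_Suc)
    then have "- s 14 * h 1 + s 9 * h 2 + s 10 * h 3 + s 11 * h 4 = - minor 0 s \<phi> 0 j (k+1)" by (simp only: minus_minus)
    then have 5: "- s 14 * h 1 + s 9 * h 2 + s 10 * h 3 + s 11 * h 4 = 0" by (simp only: m1 minus_zero)
    have "a = 0 \<or> a = 1 \<or> a = 2 \<or> a = 3 \<or> a = 4" using jk by auto
    then have "h a = 0"
      using sylvester_injective[OF r[unfolded res_infinity_def] 1 2 3 4 5] by auto
    then show ?thesis using jk by (simp add: h_def)
  qed
  obtain i j k where \<alpha>: "\<alpha> = (i, j, k)" "i + j + k = d + 1"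
    using Suc.prems by (auto simp: exponents_def)
  show ?case
  proof (cases i)
    case 0
    then show ?thesis using \<alpha> binary by simp
  next
    case (Suc i')
    then show ?thesis using \<alpha> x[of i' j k] by simp
  qed
qed

section \<open>Independence and span of the evaluations at the zeros\<close>

text \<open>Pairing the relation with the polynomial that vanishes at all other nodes isolates
  \<open>c i\<close>.\<close>

lemma lagrange_separation:
  fixes t :: "'a \<Rightarrow> complex"
  assumes "finite E" "inj_on t E" and "\<And>k. (\<Sum>i\<in>E. c i * t i ^ k) = 0" and "i \<in> E"
  shows "c i = 0"
proof -
  define p where "p = (\<Prod>a\<in>E - {i}. [:- t a, 1:])"
  have "(\<Sum>b\<in>E. c b * poly p (t b)) = (\<Sum>k\<le>degree p. coeff p k * (\<Sum>b\<in>E. c b * t b ^ k))"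
    unfolding poly_altdef sum_distrib_left by (subst sum.swap) (simp add: mult_ac)
  also have "\<dots> = 0" using assms(3) by simp
  finally have "(\<Sum>b\<in>E. c b * poly p (t b)) = 0" .
  moreover have "(\<Sum>b\<in>E. c b * poly p (t b)) = (\<Sum>b\<in>{i}. c b * poly p (t b))"
    using assms by (intro sum.mono_neutral_right) (auto simp: p_def poly_prod)
  ultimately have "c i * poly p (t i) = 0" by simp
  moreover have "poly p (t i) \<noteq> 0"
    using assms by (auto simp: p_def poly_prod prod_zero_iff dest: inj_onD)
  ultimately show ?thesis by simp
qed

text \<open>The relation defines a functional that kills all multiples of the cubics and does not
  change under multiplication by \<open>x\<close>. Vanishing in degree \<open>d\<close>, it vanishes
  in lower degrees after multiplication by powers of \<open>x\<close>, and in higher ones by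
  \<open>functional_vanishes\<close>. Its values on the powers of \<open>y\<close> then separate the
  slopes \<open>t i\<close>.\<close>

lemma evaluations_independent:
  assumes r: "res_infinity s \<noteq> 0" and E: "finite E" "inj_on t E"
    and zero: "\<And>i. i \<in> E \<Longrightarrow> zero_of s (1, t i, z i)"
    and d: "3 \<le> d" and rel: "\<And>\<alpha>. \<alpha> \<in> exponents d \<Longrightarrow> (\<Sum>i\<in>E. c i * eval_at (1, t i, z i) \<alpha>) = 0"
    and i: "i \<in> E"
  shows "c i = 0"
proof -
  define \<phi> where "\<phi> \<beta> = (\<Sum>i\<in>E. c i * eval_at (1, t i, z i) \<beta>)" for \<beta>
  have shift: "\<phi> (i+1, j, k) = \<phi> (i, j, k)" for i j k
    by (simp add: \<phi>_def eval_at_def)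
  have shifts: "\<phi> (i + n, j, k) = \<phi> (i, j, k)" for i j k n
    by (induction n) (use shift in auto)
  have kills: "minor m s \<phi> i j k = 0" if "m < 3" for m i j k
    unfolding \<phi>_def minor_sum_functional using that by (simp add: minor_eval_at_zero zero)
  have low: "\<phi> \<alpha> = 0" if "\<alpha> \<in> exponents d'" "d' \<le> d" for \<alpha> d'
  proof -
    obtain a b c where \<alpha>: "\<alpha> = (a, b, c)" by (cases \<alpha>)
    then have "\<phi> (a + (d - d'), b, c) = 0"
      using rel[of "(a + (d - d'), b, c)"] that by (simp add: \<phi>_def exponents_def)
    then show ?thesis using \<alpha> by (simp add: shifts)
  qed
  have "\<phi> \<alpha> = 0" if "\<alpha> \<in> exponents d'" for \<alpha> d'
  proof (cases "d' \<le> 3")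
    case True
    then show ?thesis using low[OF that] d by simp
  next
    case False
    then show ?thesis
      using functional_vanishes[OF r kills shift low[OF _ d] _ that] by simp
  qed
  then have "\<phi> (0, k, 0) = 0" for k by (simp add: exponents_def)
  then have "(\<Sum>i\<in>E. c i * t i ^ k) = 0" for k by (simp add: \<phi>_def eval_at_def)
  then show ?thesis using lagrange_separation[OF E _ i] by blast
qed

lemma card_exponents: "card (exponents d) = (\<Sum>i\<le>d. Suc (d - i))"
proof -
  have "bij_betw (\<lambda>(i, j). (i, j, d - i - j)) (SIGMA i:{..d}. {..d - i}) (exponents d)"
    by (rule bij_betw_byWitness[where f' = "\<lambda>(i, j, k). (i, j)"]) (auto simp: exponents_def)
  then show ?thesis by (simp flip: bij_betw_same_card)
qed

lemma card_exponents_3: "card (exponents 3) = 10" and card_exponents_4: "card (exponents 4) = 15"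
  by (simp_all add: card_exponents atMost_nat_numeral numeral_eq_Suc)

text \<open>On \<open>x = 0\<close> the relation reads \<open>(- c 2 y + c 1 z) q\<^sub>0 - c 0 (z
  q\<^sub>1 - y q\<^sub>2) = 0\<close>, so the transposed Sylvester matrix applies. The index
  \<open>i\<close> admits cubics multiplied by a power of \<open>x\<close>.\<close>

lemma cubic_relations_independent:
  assumes r: "res_infinity s \<noteq> 0"
    and rel: "\<And>j k. j + k = 3 \<Longrightarrow>
      c 0 * minor 0 s (basis_functional (i, j, k)) i 0 0 + c 1 * minor 1 s (basis_functional (i, j, k)) i 0 0
      + c (2::nat) * minor 2 s (basis_functional (i, j, k)) i 0 0 = 0"
  shows "c 0 = 0" "c 1 = 0" "c 2 = 0"
proof -
  have 1: "s 3 * - c 2 + - s 14 * - c 0 = 0"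
    using rel[of 3 0] by (simp add: minor_defs basis_functional_def algebra_simps)
  have 2: "s 4 * - c 2 + s 3 * c 1 + s 9 * - c 0 + - s 14 * 0 = 0"
    using rel[of 2 1] by (simp add: minor_defs basis_functional_def algebra_simps)
  have 3: "s 5 * - c 2 + s 4 * c 1 + s 3 * 0 + s 10 * - c 0 + s 9 * 0 = 0"
    using rel[of 1 2] by (simp add: minor_defs basis_functional_def algebra_simps)
  have 4: "s 5 * c 1 + s 4 * 0 + s 11 * - c 0 + s 10 * 0 = 0"
    using rel[of 0 3] by (simp add: minor_defs basis_functional_def algebra_simps)
  have 5: "s 5 * 0 + s 11 * 0 = 0" by simp
  show "c 0 = 0" "c 1 = 0" "c 2 = 0"
    using sylvester_injective_transposed[OF r[unfolded res_infinity_def] 1 2 3 4 5] by simp_all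
qed

text \<open>The count is \<open>3 + 7 = 10\<close>: three independent cubics and seven independent
  evaluations annihilate each other.\<close>

lemma cubic_spanned:
  assumes r: "res_infinity s \<noteq> 0" and E: "finite E" "card E = 7" "inj_on t E"
    and zero: "\<And>i. i \<in> E \<Longrightarrow> zero_of s (1, t i, z i)"
    and kills: "\<And>m. m < 3 \<Longrightarrow> minor m s \<phi> 0 0 0 = 0"
  shows "\<exists>c. \<forall>\<alpha>\<in>exponents 3. \<phi> \<alpha> = (\<Sum>i\<in>E. c i * eval_at (1, t i, z i) \<alpha>)"
proof (rule annihilator_spanned[where G = "{..<3::nat}" and g = "\<lambda>m \<alpha>. minor m s (basis_functional \<alpha>) 0 0 0"
      and E = E and e = "\<lambda>i. eval_at (1, t i, z i)" and X = "exponents 3" and u = \<phi>])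
  show "card {..<3::nat} + card E = card (exponents 3)" using E by (simp add: card_exponents_3)
next
  fix c assume rel: "\<forall>\<alpha>\<in>exponents 3. (\<Sum>m<3::nat. c m * minor m s (basis_functional \<alpha>) 0 0 0) = 0"
  have sum3: "(\<Sum>m<3. h m) = h 0 + h 1 + h (2::nat)" for h :: "nat \<Rightarrow> complex"
    by (simp add: lessThan_nat_numeral lessThan_Suc add_ac)
  have "c 0 * minor 0 s (basis_functional (0, j, k)) 0 0 0 + c 1 * minor 1 s (basis_functional (0, j, k)) 0 0 0
      + c 2 * minor 2 s (basis_functional (0, j, k)) 0 0 0 = 0" if "j + k = 3" for j k
    using bspec[OF rel, of "(0, j, k)"] that unfolding sum3 by (simp add: exponents_def)
  then have "c 0 = 0" "c 1 = 0" "c 2 = 0"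
    using cubic_relations_independent[OF r, of c 0] by blast+
  then show "\<forall>m\<in>{..<3}. c m = 0" using less_3_cases by auto
next
  fix c assume "\<forall>\<alpha>\<in>exponents 3. (\<Sum>i\<in>E. c i * eval_at (1, t i, z i) \<alpha>) = 0"
  then show "\<forall>i\<in>E. c i = 0"
    using evaluations_independent[OF r E(1,3) zero, of 3 c] by auto
next
  fix m i assume "m \<in> {..<3::nat}" "i \<in> E"
  then show "(\<Sum>\<alpha>\<in>exponents 3. minor m s (basis_functional \<alpha>) 0 0 0 * eval_at (1, t i, z i) \<alpha>) = 0"
    by (simp add: minor_eval_at_zero zero flip: minor_expand)
next
  fix m assume "m \<in> {..<3::nat}"
  then show "(\<Sum>\<alpha>\<in>exponents 3. minor m s (basis_functional \<alpha>) 0 0 0 * \<phi> \<alpha>) = 0"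
    by (simp add: kills flip: minor_expand)
qed (use E in auto)

text \<open>For \<open>n < 9\<close>, \<open>n div 3\<close> numbers the variable and
  \<open>n mod 3\<close> the cubic multiplied by it.\<close>

definition quartic_minor :: "nat \<Rightarrow> (nat \<Rightarrow> complex) \<Rightarrow> functional \<Rightarrow> complex"
  where "quartic_minor n s \<phi> =
    (if n < 3 then minor n s \<phi> 1 0 0 else if n < 6 then minor (n - 3) s \<phi> 0 1 0 else minor (n - 6) s \<phi> 0 0 1)"

lemma sum_less_8:
  "(\<Sum>a<8. h a) = h 0 + h 1 + h 2 + h 3 + h 4 + h 5 + h 6 + h (7::nat)"
  by (simp add: lessThan_nat_numeral lessThan_Suc add_ac)

lemma less_8_cases: "(n::nat) < 8 \<Longrightarrow> n = 0 \<or> n = 1 \<or> n = 2 \<or> n = 3 \<or> n = 4 \<or> n = 5 \<or> n = 6 \<or> n = 7"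
  by auto

text \<open>The ninth product \<open>z (x q\<^sub>1 - y q\<^sub>0)\<close> is a combination of the other eight.\<close>

lemma quartic_relations_independent:
  assumes r: "res_infinity s \<noteq> 0"
    and rel: "\<And>\<alpha>. \<alpha> \<in> exponents 4 \<Longrightarrow> (\<Sum>n<8. c n * quartic_minor n s (basis_functional \<alpha>)) = 0"
    and n: "n < 8"
  shows "c n = 0"
proof -
  note rel' = rel[unfolded sum_less_8]
  \<comment> \<open>Monomials free of \<open>x\<close> see only the products with \<open>y\<close>
    and \<open>z\<close>; on \<open>x = 0\<close> these combine to \<open>(- c 5 y^2 + c 4 y z + c 7
    z^2) q\<^sub>0 - (c 3 y + c 6 z) (z q\<^sub>1 - y q\<^sub>2)\<close>.\<close>
  have 1: "s 3 * - c 5 + - s 14 * - c 3 = 0"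
    using rel'[of "(0, 4, 0)"]
    by (simp add: quartic_minor_def exponents_def minor_defs basis_functional_def algebra_simps)
  have 2: "s 4 * - c 5 + s 3 * c 4 + s 9 * - c 3 + - s 14 * - c 6 = 0"
    using rel'[of "(0, 3, 1)"]
    by (simp add: quartic_minor_def exponents_def minor_defs basis_functional_def algebra_simps)
  have 3: "s 5 * - c 5 + s 4 * c 4 + s 3 * c 7 + s 10 * - c 3 + s 9 * - c 6 = 0"
    using rel'[of "(0, 2, 2)"]
    by (simp add: quartic_minor_def exponents_def minor_defs basis_functional_def algebra_simps)
  have 4: "s 5 * c 4 + s 4 * c 7 + s 11 * - c 3 + s 10 * - c 6 = 0"
    using rel'[of "(0, 1, 3)"]
    by (simp add: quartic_minor_def exponents_def minor_defs basis_functional_def algebra_simps)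
  have 5: "s 5 * c 7 + s 11 * - c 6 = 0"
    using rel'[of "(0, 0, 4)"]
    by (simp add: quartic_minor_def exponents_def minor_defs basis_functional_def algebra_simps)
  have a: "c 3 = 0" "c 4 = 0" "c 5 = 0" "c 6 = 0" "c 7 = 0"
    using sylvester_injective_transposed[OF r[unfolded res_infinity_def] 1 2 3 4 5] by simp_all
  \<comment> \<open>What remains is \<open>x\<close> times a combination of the cubics, read off at
    monomials with a single factor \<open>x\<close>.\<close>
  have "c 0 * minor 0 s (basis_functional (1, j, k)) 1 0 0 + c 1 * minor 1 s (basis_functional (1, j, k)) 1 0 0
      + c 2 * minor 2 s (basis_functional (1, j, k)) 1 0 0 = 0" if "j + k = 3" for j k
    using rel'[of "(1, j, k)"] that by (simp add: quartic_minor_def exponents_def a)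
  then have "c 0 = 0" "c 1 = 0" "c 2 = 0"
    using cubic_relations_independent[OF r, of c 1] by blast+
  then show ?thesis using less_8_cases[OF n] a by auto
qed

lemma quartic_minor_expand:
  "quartic_minor n s \<phi> = (\<Sum>\<alpha>\<in>exponents 4. quartic_minor n s (basis_functional \<alpha>) * \<phi> \<alpha>)"
  unfolding quartic_minor_def by (simp flip: minor_expand)

lemma quartic_minor_eval_at_zero: "zero_of s p \<Longrightarrow> n < 9 \<Longrightarrow> quartic_minor n s (eval_at p) = 0"
  by (simp add: quartic_minor_def minor_eval_at_zero)

text \<open>For quartics the count is \<open>8 + 7 = 15\<close>.\<close>

lemma quartic_spanned:
  assumes r: "res_infinity s \<noteq> 0" and E: "finite E" "card E = 7" "inj_on t E"
    and zero: "\<And>i. i \<in> E \<Longrightarrow> zero_of s (1, t i, z i)"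
    and kills: "\<And>n. n < 8 \<Longrightarrow> quartic_minor n s \<phi> = 0"
  shows "\<exists>c. \<forall>\<alpha>\<in>exponents 4. \<phi> \<alpha> = (\<Sum>i\<in>E. c i * eval_at (1, t i, z i) \<alpha>)"
proof (rule annihilator_spanned[where G = "{..<8::nat}" and g = "\<lambda>n \<alpha>. quartic_minor n s (basis_functional \<alpha>)"
      and E = E and e = "\<lambda>i. eval_at (1, t i, z i)" and X = "exponents 4" and u = \<phi>])
  show "card {..<8::nat} + card E = card (exponents 4)" using E by (simp add: card_exponents_4)
next
  fix c assume "\<forall>\<alpha>\<in>exponents 4. (\<Sum>n<8::nat. c n * quartic_minor n s (basis_functional \<alpha>)) = 0"
  then show "\<forall>n\<in>{..<8}. c n = 0" using quartic_relations_independent[OF r, of c] by auto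
next
  fix c assume "\<forall>\<alpha>\<in>exponents 4. (\<Sum>i\<in>E. c i * eval_at (1, t i, z i) \<alpha>) = 0"
  then show "\<forall>i\<in>E. c i = 0"
    using evaluations_independent[OF r E(1,3) zero, of 4 c] by auto
next
  fix n i assume "n \<in> {..<8::nat}" "i \<in> E"
  then show "(\<Sum>\<alpha>\<in>exponents 4. quartic_minor n s (basis_functional \<alpha>) * eval_at (1, t i, z i) \<alpha>) = 0"
    by (simp add: quartic_minor_eval_at_zero zero flip: quartic_minor_expand)
next
  fix n assume "n \<in> {..<8::nat}"
  then show "(\<Sum>\<alpha>\<in>exponents 4. quartic_minor n s (basis_functional \<alpha>) * \<phi> \<alpha>) = 0"
    by (simp add: kills flip: quartic_minor_expand)
qed (use E in auto)

text \<open>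
  On the line \<open>y = t x\<close> a section vanishes at \<open>(1, t, z)\<close> iff \<open>z\<close> is a common root of a quadratic
  polynomial with coefficients \<open>quad2, quad1, quad0\<close> and a cubic one with coefficients
  \<open>cub3, \<dots>, cub0\<close>, all of them polynomials in \<open>t\<close>.
\<close>

definition "quad2 s = [:s 11, - s 5:]" for s :: "nat \<Rightarrow> complex"
definition "quad1 s = [:s 8, s 10 - s 2, - s 4:]" for s :: "nat \<Rightarrow> complex"
definition "quad0 s = [:s 6, s 7 - s 0, s 9 - s 1, - s 3:]" for s :: "nat \<Rightarrow> complex"
definition "cub3 s = [:s 5:]" for s :: "nat \<Rightarrow> complex"
definition "cub2 s = [:s 2, s 4:]" for s :: "nat \<Rightarrow> complex"
definition "cub1 s = [:s 0, s 1, s 3:]" for s :: "nat \<Rightarrow> complex"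
definition "cub0 s = [:- s 12, - s 13, - s 14:]" for s :: "nat \<Rightarrow> complex"

lemmas fibre_defs = quad2_def quad1_def quad0_def cub3_def cub2_def cub1_def cub0_def

definition "eliminant s = res23 (quad2 s) (quad1 s) (quad0 s) (cub3 s) (cub2 s) (cub1 s) (cub0 s)"

definition "subeliminant s = subres1 (quad2 s) (quad1 s) (quad0 s) (cub3 s) (cub2 s) (cub1 s)"

definition "fibre_root s t =
  - subres0 (poly (quad2 s) t) (poly (quad1 s) t) (poly (quad0 s) t) (poly (cub3 s) t) (poly (cub2 s) t)
      (poly (cub0 s) t) / poly (subeliminant s) t"

text \<open>At \<open>x = 1\<close> the Koszul relation expresses minor 0 through the other
  two.\<close>

lemma zero_of_affine:
  "zero_of s (1, t, z) \<longleftrightarrow>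
     poly (quad2 s) t * z^2 + poly (quad1 s) t * z + poly (quad0 s) t = 0 \<and>
     poly (cub3 s) t * z^3 + poly (cub2 s) t * z^2 + poly (cub1 s) t * z + poly (cub0 s) t = 0"
  (is "_ \<longleftrightarrow> ?A = 0 \<and> ?B = 0")
proof -
  have "minor 2 s (eval_at (1, t, z)) 0 0 0 = ?A" "minor 1 s (eval_at (1, t, z)) 0 0 0 = ?B"
    "minor 0 s (eval_at (1, t, z)) 0 0 0 = - (t * ?B + z * ?A)"
    by (simp_all add: minor_defs eval_at_def fibre_defs power2_eq_square power3_eq_cube algebra_simps)
  then show ?thesis unfolding zero_of_def all_less_3 by auto
qed

lemma zero_of_imp_root: "zero_of s (1, t, z) \<Longrightarrow> poly (eliminant s) t = 0"
  unfolding zero_of_affine eliminant_def poly_res23 using res23_common_root by blast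

lemma zero_of_unique:
  "zero_of s (1, t, z) \<Longrightarrow> poly (subeliminant s) t \<noteq> 0 \<Longrightarrow> z = fibre_root s t"
  unfolding zero_of_affine fibre_root_def subeliminant_def poly_subres1 using common_root_unique by blast

lemma zero_of_fibre_root:
  "poly (eliminant s) t = 0 \<Longrightarrow> poly (subeliminant s) t \<noteq> 0 \<Longrightarrow> zero_of s (1, t, fibre_root s t)"
  unfolding zero_of_affine fibre_root_def subeliminant_def eliminant_def poly_subres1 poly_res23
  using common_root_exists by blast

text \<open>
  A priori the eliminant has degree 9 as a polynomial of \<open>t\<close>. Replacing the cubic polynomial by
  another element of the ideal multiplies it by \<open>t\<^sup>2\<close>, without changing this bound.
\<close>

lemma top_coeff_eliminant: "top_coeff 7 (eliminant s) (- res_infinity s)"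
proof -
  let ?t = "[:0, 1:] :: complex poly"
  \<comment> \<open>The new cubic polynomial is \<open>z q\<^sub>1 - y q\<^sub>2\<close> at
    \<open>(1, t, z)\<close>: in its coefficients the top terms of \<open>?t * cub\<close> and
    \<open>quad\<close> cancel, which gives the degrees required by \<open>top_coeff_res23\<close>.
    Up to sign, the top coefficients are those of the restriction to \<open>x = 0\<close>.\<close>
  have "top_coeff 9 (res23 (quad2 s) (quad1 s) (quad0 s) (?t * cub3 s + quad2 s) (?t * cub2 s + quad1 s)
      (?t * cub1 s + quad0 s) (?t * cub0 s))
    (res23 (- s 5) (- s 4) (- s 3) (s 11) (s 10) (s 9) (- s 14))"
    by (rule top_coeff_res23)
       (simp_all add: top_coeff_def fibre_defs numeral_eq_Suc)
  \<comment> \<open>Each monomial of \<open>res23\<close> has three factors from the quadratic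
    polynomial, hence the sign.\<close>
  moreover have "res23 (- s 5) (- s 4) (- s 3) (s 11) (s 10) (s 9) (- s 14) = - res_infinity s"
    unfolding res_infinity_def res23_def by simp
  moreover have "?t * ?t * p = pCons 0 (pCons 0 p)" for p by simp
  ultimately have *: "top_coeff 9 (pCons 0 (pCons 0 (eliminant s))) (- res_infinity s)"
    by (simp only: res23_combine flip: eliminant_def)
  then show ?thesis
    by (cases "eliminant s = 0") (simp_all add: top_coeff_def numeral_eq_Suc)
qed

lemma degree_eliminant: "degree (eliminant s) \<le> 7"
  using top_coeff_eliminant by (simp add: top_coeff_def)

lemma coeff_eliminant: "coeff (eliminant s) 7 = - res_infinity s"
  using top_coeff_eliminant by (simp add: top_coeff_def)

lemma top_coeff_mult3:
  "top_coeff m1 p1 a1 \<Longrightarrow> top_coeff m2 p2 a2 \<Longrightarrow> top_coeff m3 p3 a3 \<Longrightarrow> m1 + m2 + m3 = n \<Longrightarrow>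
   top_coeff n (p1 * p2 * p3) (a1 * a2 * a3)"
  by (blast intro: top_coeff_mult)

lemma degree_subeliminant: "degree (subeliminant s) \<le> 4"
proof -
  have *: "top_coeff 1 (quad2 s) (- s 5)" "top_coeff 2 (quad1 s) (- s 4)" "top_coeff 3 (quad0 s) (- s 3)"
    "top_coeff 0 (cub3 s) (s 5)" "top_coeff 1 (cub2 s) (s 4)" "top_coeff 2 (cub1 s) (s 3)"
    by (simp_all add: top_coeff_def fibre_defs numeral_eq_Suc)
  have "top_coeff 4 (subeliminant s) (subres1 (- s 5) (- s 4) (- s 3) (s 5) (s 4) (s 3))"
    unfolding subeliminant_def subres1_def
    by (intro top_coeff_add top_coeff_diff; (rule top_coeff_mult3, (rule *)+, simp))
  then show ?thesis by (simp add: top_coeff_def)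
qed

text \<open>No zero on \<open>x = 0\<close>, seven distinct slopes \<open>t\<close>, and a single
  zero over each slope. The last two conditions are merged into one product to be handled by
  \<open>generic_coprime\<close>.\<close>

definition good_section :: "(nat \<Rightarrow> complex) \<Rightarrow> bool"
  where "good_section s \<longleftrightarrow> res_infinity s \<noteq> 0 \<and>
    (\<forall>t. poly (eliminant s) t = 0 \<longrightarrow> poly (pderiv (eliminant s) * subeliminant s) t \<noteq> 0)"

definition roots :: "(nat \<Rightarrow> complex) \<Rightarrow> complex set"
  where "roots s = {t. poly (eliminant s) t = 0}"

text \<open>The coefficient of \<open>t^7\<close> in the eliminant is
  \<open>- res_infinity s\<close>, so its degree is exactly 7, and all its roots are simple.\<close>

lemma
  assumes "good_section s"
  shows finite_roots: "finite (roots s)" and card_roots: "card (roots s) = 7"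
proof -
  have r: "res_infinity s \<noteq> 0" using assms by (simp add: good_section_def)
  then have nz: "eliminant s \<noteq> 0" using coeff_eliminant[of s] by auto
  have "degree (eliminant s) = 7"
    using degree_eliminant[of s] coeff_eliminant[of s] r by (metis le_antisym le_degree neg_equal_0_iff_equal)
  moreover have "card (roots s) = degree (eliminant s)" unfolding roots_def
    using assms nz by (intro card_roots_squarefree) (auto simp: good_section_def)
  ultimately show "card (roots s) = 7" by simp
  show "finite (roots s)" using nz by (simp add: roots_def poly_roots_finite)
qed

lemma zero_of_good_section:
  assumes "good_section s" "zero_of s (x, y, z)" "(x, y, z) \<noteq> (0, 0, 0)"
  shows "x \<noteq> 0" "y / x \<in> roots s" "z / x = fibre_root s (y / x)"
proof -
  show x: "x \<noteq> 0"
    using zero_of_at_infinity[of s y z] assms by (auto simp: good_section_def)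
  have 1: "zero_of s (1, y / x, z / x)"
    using zero_of_scale[of "1 / x" s x y z] x assms by simp
  from zero_of_imp_root[OF this] show root: "y / x \<in> roots s" by (simp add: roots_def)
  show "z / x = fibre_root s (y / x)"
    using zero_of_unique[OF 1] root assms by (simp add: good_section_def roots_def)
qed

lemma zero_of_root: "good_section s \<Longrightarrow> t \<in> roots s \<Longrightarrow> zero_of s (1, t, fibre_root s t)"
  by (rule zero_of_fibre_root) (auto simp: roots_def good_section_def)

section \<open>Moments of forms\<close>

lemma lookup_single_mult:
  "Poly_Mapping.lookup (Poly_Mapping.single e a * p) (e + m) = (a::complex) * Poly_Mapping.lookup p (m :: 'v \<Rightarrow>\<^sub>0 nat)"
proof -
  have "Poly_Mapping.single e a * p =
      (\<Sum>m'\<in>Poly_Mapping.keys p. Poly_Mapping.single (e + m') (a * Poly_Mapping.lookup p m'))"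
    by (subst (1) poly_mapping_eq_sum_single[of p]) (simp only: sum_distrib_left mult_single)
  then show ?thesis by (simp add: lookup_sum lookup_single when_def in_keys_iff)
qed

lemma lookup_single_mult_0:
  assumes "\<And>m'. m \<noteq> e + m'"
  shows "Poly_Mapping.lookup (Poly_Mapping.single e (a::complex) * p) (m :: 'v \<Rightarrow>\<^sub>0 nat) = 0"
proof -
  have "Poly_Mapping.single e a * p =
      (\<Sum>m'\<in>Poly_Mapping.keys p. Poly_Mapping.single (e + m') (a * Poly_Mapping.lookup p m'))"
    by (subst (1) poly_mapping_eq_sum_single[of p]) (simp only: sum_distrib_left mult_single)
  moreover have "e + m' \<noteq> m" for m' using assms by metis
  ultimately show ?thesis by (simp add: lookup_sum lookup_single when_def)
qed

lemma lookup_scale: "Poly_Mapping.lookup (scale c p) m = c * Poly_Mapping.lookup p m"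
  using lookup_single_mult[of 0 c p m] by (simp add: scale_def)

definition degree_of :: "('v::finite \<Rightarrow>\<^sub>0 nat) \<Rightarrow> nat"
  where "degree_of m = (\<Sum>v\<in>UNIV. Poly_Mapping.lookup m v)"

lemma forms_iff: "p \<in> forms d \<longleftrightarrow> (\<forall>m. degree_of m \<noteq> d \<longrightarrow> Poly_Mapping.lookup p m = 0)"
  unfolding forms_def degree_of_def by (auto simp: in_keys_iff)

lemma degree_of_add: "degree_of (m + m') = degree_of m + degree_of m'"
  by (simp add: degree_of_def lookup_add sum.distrib)

lemma degree_of_single: "degree_of (Poly_Mapping.single v n) = n"
  by (simp add: degree_of_def lookup_single when_def)

definition var_coeff :: "'v::finite cpoly \<Rightarrow> 'v \<Rightarrow> complex"
  where "var_coeff l v = Poly_Mapping.lookup l (Poly_Mapping.single v 1)"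

lemma degree_of_1E:
  assumes "degree_of m = 1"
  obtains v where "m = Poly_Mapping.single v 1"
proof -
  have "\<exists>v. Poly_Mapping.lookup m v \<noteq> 0"
  proof (rule ccontr)
    assume "\<not> ?thesis"
    then show False using assms by (simp add: degree_of_def)
  qed
  then obtain v where v: "Poly_Mapping.lookup m v \<noteq> 0" by blast
  have "degree_of m = Poly_Mapping.lookup m v + (\<Sum>w\<in>UNIV - {v}. Poly_Mapping.lookup m w)"
    by (simp add: degree_of_def sum.remove[of UNIV v])
  then have "Poly_Mapping.lookup m v = 1" "(\<Sum>w\<in>UNIV - {v}. Poly_Mapping.lookup m w) = 0"
    using assms v by linarith+
  then have "Poly_Mapping.lookup m v = 1" "\<forall>w\<in>UNIV - {v}. Poly_Mapping.lookup m w = 0"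
    by (simp_all only: sum_eq_0_iff finite)
  then have "m = Poly_Mapping.single v 1"
    by (intro poly_mapping_eqI) (auto simp: lookup_single when_def)
  then show ?thesis using that by blast
qed

lemma single_one_eq_iff: "Poly_Mapping.single v (Suc 0) = Poly_Mapping.single w (Suc 0) \<longleftrightarrow> v = w"
  by (metis keys_single nat.distinct(1) singleton_inject)

lemma linear_form_eq:
  assumes "l \<in> forms 1"
  shows "l = (\<Sum>v\<in>UNIV. Poly_Mapping.single (Poly_Mapping.single v 1) (var_coeff l v))"
proof (rule poly_mapping_eqI)
  fix m
  show "Poly_Mapping.lookup l m =
    Poly_Mapping.lookup (\<Sum>v\<in>UNIV. Poly_Mapping.single (Poly_Mapping.single v 1) (var_coeff l v)) m"
  proof (cases "degree_of m = 1")
    case True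
    then obtain w where "m = Poly_Mapping.single w 1" by (rule degree_of_1E)
    then show ?thesis
      by (simp add: lookup_sum lookup_single when_def single_one_eq_iff var_coeff_def)
  next
    case False
    then have "m \<noteq> Poly_Mapping.single w 1" for w by (auto simp: degree_of_single)
    then have "Poly_Mapping.single w 1 \<noteq> m" for w by metis
    then show ?thesis using assms False
      by (simp add: lookup_sum lookup_single when_def forms_iff)
  qed
qed

lemma power_in_forms:
  fixes l :: "'v::finite cpoly"
  assumes "l \<in> forms 1"
  shows "l ^ d \<in> forms d"
proof (induction d)
  case 0
  show ?case by (auto simp: forms_iff lookup_one when_def degree_of_def)
next
  case (Suc d)
  show ?case unfolding forms_iff
  proof (intro allI impI)
    fix m :: "'v \<Rightarrow>\<^sub>0 nat" assume m: "degree_of m \<noteq> Suc d"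
    have "Poly_Mapping.lookup (Poly_Mapping.single (Poly_Mapping.single v 1) (var_coeff l v) * l ^ d) m = 0" for v
    proof (cases "\<exists>m'. m = Poly_Mapping.single v 1 + m'")
      case True
      then obtain m' where m': "m = Poly_Mapping.single v 1 + m'" by blast
      then have "degree_of m' \<noteq> d" using m by (simp add: degree_of_add degree_of_single)
      then show ?thesis using Suc unfolding m' lookup_single_mult by (simp add: forms_iff)
    next
      case False
      then show ?thesis by (intro lookup_single_mult_0) blast
    qed
    moreover have "l ^ Suc d = (\<Sum>v\<in>UNIV. Poly_Mapping.single (Poly_Mapping.single v 1) (var_coeff l v) * l ^ d)"
      unfolding power_Suc by (subst (1) linear_form_eq[OF assms]) (rule sum_distrib_right)
    ultimately show "Poly_Mapping.lookup (l ^ Suc d) m = 0" by (simp add: lookup_sum)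
  qed
qed

text \<open>The multinomial theorem with cleared denominators. After splitting off one factor
  \<open>l\<close>, the contribution of the variable \<open>v\<close> is proportional to the
  exponent of \<open>v\<close> in \<open>m\<close>, and these exponents add up to the
  degree.\<close>

lemma lookup_power_linear_form:
  assumes l: "l \<in> forms 1"
  shows "degree_of m = d \<Longrightarrow>
    (\<Prod>v\<in>UNIV. fact (Poly_Mapping.lookup m v)) * Poly_Mapping.lookup (l ^ d) m =
    fact d * (\<Prod>v\<in>UNIV. var_coeff l v ^ Poly_Mapping.lookup m v)"
proof (induction d arbitrary: m)
  case 0
  then have "\<forall>v. Poly_Mapping.lookup m v = 0" by (simp add: degree_of_def)
  then have "m = 0" by (intro poly_mapping_eqI) simp
  then show ?case by simp
next
  case (Suc d)
  let ?e = "\<lambda>v. Poly_Mapping.single v 1" and ?f = "\<lambda>m. \<Prod>v\<in>UNIV. fact (Poly_Mapping.lookup m v) :: complex"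
  let ?M = "\<lambda>m. \<Prod>v\<in>UNIV. var_coeff l v ^ Poly_Mapping.lookup m v"
  have summand: "?f m * Poly_Mapping.lookup (Poly_Mapping.single (?e v) (var_coeff l v) * l ^ d) m =
      of_nat (Poly_Mapping.lookup m v) * (fact d * ?M m)" for v
  proof (cases "Poly_Mapping.lookup m v = 0")
    case True
    then have "m \<noteq> ?e v + m'" for m' by (auto simp: lookup_add dest: arg_cong[of _ _ "\<lambda>m. Poly_Mapping.lookup m v"])
    then show ?thesis using True by (simp add: lookup_single_mult_0)
  next
    case False
    define m' where "m' = m - ?e v"
    have m: "m = ?e v + m'"
      by (rule poly_mapping_eqI) (use False in \<open>auto simp: m'_def lookup_add lookup_minus lookup_single when_def\<close>)
    have d: "degree_of m' = d" using Suc.prems by (simp add: m degree_of_add degree_of_single)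
    have look: "Poly_Mapping.lookup m v = Suc (Poly_Mapping.lookup m' v)"
      "\<And>w. w \<noteq> v \<Longrightarrow> Poly_Mapping.lookup m w = Poly_Mapping.lookup m' w"
      by (auto simp: m lookup_add lookup_single when_def)
    have f: "?f m = of_nat (Poly_Mapping.lookup m v) * ?f m'"
      using look by (simp add: prod.remove[of UNIV v])
    have M: "?M m = var_coeff l v * ?M m'"
      using look by (simp add: prod.remove[of UNIV v])
    have "Poly_Mapping.lookup (Poly_Mapping.single (?e v) (var_coeff l v) * l ^ d) m =
        var_coeff l v * Poly_Mapping.lookup (l ^ d) m'"
      unfolding m by (rule lookup_single_mult)
    then show ?thesis using Suc.IH[OF d] by (simp add: f M algebra_simps)
  qed
  have "l ^ Suc d = (\<Sum>v\<in>UNIV. Poly_Mapping.single (?e v) (var_coeff l v) * l ^ d)"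
    unfolding power_Suc by (subst (1) linear_form_eq[OF l]) (rule sum_distrib_right)
  then have "?f m * Poly_Mapping.lookup (l ^ Suc d) m =
      (\<Sum>v\<in>UNIV. of_nat (Poly_Mapping.lookup m v) * (fact d * ?M m))"
    by (simp only: lookup_sum sum_distrib_left summand)
  also have "\<dots> = of_nat (degree_of m) * (fact d * ?M m)"
    by (simp add: degree_of_def sum_distrib_right)
  finally show ?case using Suc.prems by (simp add: algebra_simps)
qed

section \<open>Ternary forms and their moments\<close>

text \<open>The elements \<open>1\<close>, \<open>2\<close>, \<open>3\<close> of the index type
  \<open>3\<close> stand for the variables \<open>x\<close>, \<open>y\<close>,
  \<open>z\<close>.\<close>

definition exponent :: "nat \<times> nat \<times> nat \<Rightarrow> (3 \<Rightarrow>\<^sub>0 nat)"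
  where "exponent = (\<lambda>(i, j, k). Poly_Mapping.single 1 i + Poly_Mapping.single 2 j + Poly_Mapping.single 3 k)"

lemma lookup_exponent [simp]:
  "Poly_Mapping.lookup (exponent (i, j, k)) 1 = i"
  "Poly_Mapping.lookup (exponent (i, j, k)) 2 = j"
  "Poly_Mapping.lookup (exponent (i, j, k)) 3 = k"
  by (simp_all add: exponent_def lookup_add lookup_single when_def)

lemma exponent_eq_iff: "exponent \<alpha> = exponent \<beta> \<longleftrightarrow> \<alpha> = \<beta>"
  by (cases \<alpha>; cases \<beta>) (metis lookup_exponent)

lemma degree_of_exponent: "degree_of (exponent \<alpha>) = d \<longleftrightarrow> \<alpha> \<in> exponents d"
  by (cases \<alpha>) (simp add: degree_of_def sum_3 exponents_def)

lemma exponentE: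
  obtains \<alpha> where "m = exponent \<alpha>"
proof -
  let ?\<alpha> = "(Poly_Mapping.lookup m 1, Poly_Mapping.lookup m 2, Poly_Mapping.lookup m 3)"
  have "\<forall>v. Poly_Mapping.lookup m v = Poly_Mapping.lookup (exponent ?\<alpha>) v"
    unfolding forall_3 by simp
  then have "m = exponent ?\<alpha>" by (intro poly_mapping_eqI) blast
  then show ?thesis by (rule that)
qed

text \<open>The normalisation of the apolarity pairing turns \<open>l\<^sup>d\<close> into the evaluation at \<open>l\<close>.\<close>

definition moments :: "3 cpoly \<Rightarrow> functional"
  where "moments p = (\<lambda>(i, j, k).
    fact i * fact j * fact k / fact (i + j + k) * Poly_Mapping.lookup p (exponent (i, j, k)))"

definition point :: "3 cpoly \<Rightarrow> complex \<times> complex \<times> complex"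
  where "point l = (var_coeff l 1, var_coeff l 2, var_coeff l 3)"

definition linear_form :: "complex \<times> complex \<times> complex \<Rightarrow> 3 cpoly"
  where "linear_form = (\<lambda>(x, y, z). Poly_Mapping.single (exponent (1, 0, 0)) x
    + Poly_Mapping.single (exponent (0, 1, 0)) y + Poly_Mapping.single (exponent (0, 0, 1)) z)"

lemma prod_UNIV_3: "(\<Prod>v\<in>(UNIV :: 3 set). g v) = g 1 * g 2 * g 3"
  unfolding UNIV_3 by (simp add: mult_ac)

lemma moments_power:
  assumes "l \<in> forms 1" "\<alpha> \<in> exponents d"
  shows "moments (l ^ d) \<alpha> = eval_at (point l) \<alpha>"
proof -
  obtain i j k where \<alpha>: "\<alpha> = (i, j, k)" by (cases \<alpha>)
  have d: "i + j + k = d" using assms \<alpha> by (simp add: exponents_def)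
  have "degree_of (exponent \<alpha>) = d" using assms by (simp add: degree_of_exponent)
  from lookup_power_linear_form[OF assms(1) this]
  have "fact i * fact j * fact k * Poly_Mapping.lookup (l ^ d) (exponent \<alpha>) = fact d * eval_at (point l) \<alpha>"
    by (simp only: \<alpha> prod_UNIV_3 lookup_exponent eval_at_def point_def prod.case fst_conv snd_conv)
  moreover have "moments (l ^ d) \<alpha> =
      (fact i * fact j * fact k * Poly_Mapping.lookup (l ^ d) (exponent \<alpha>)) / fact d"
    by (simp add: \<alpha> moments_def d)
  ultimately show ?thesis by simp
qed

lemma moments_scale: "moments (scale c p) \<alpha> = c * moments p \<alpha>"
  by (cases \<alpha>) (simp add: moments_def lookup_scale)

lemma moments_sum: "moments (\<Sum>i\<in>I. p i) \<alpha> = (\<Sum>i\<in>I. moments (p i) \<alpha>)"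
  by (cases \<alpha>) (simp add: moments_def lookup_sum sum_distrib_left)

lemma moments_eq_0_iff: "moments p \<alpha> = 0 \<longleftrightarrow> Poly_Mapping.lookup p (exponent \<alpha>) = 0"
  by (cases \<alpha>) (simp add: moments_def)

lemma forms_eqI:
  assumes "p \<in> forms d" "q \<in> forms d" "\<And>\<alpha>. \<alpha> \<in> exponents d \<Longrightarrow> moments p \<alpha> = moments q \<alpha>"
  shows "p = q"
proof (rule poly_mapping_eqI)
  fix m
  obtain \<alpha> where \<alpha>: "m = exponent \<alpha>" by (rule exponentE)
  show "Poly_Mapping.lookup p m = Poly_Mapping.lookup q m"
  proof (cases "degree_of m = d")
    case True
    then have "moments p \<alpha> = moments q \<alpha>" using assms(3) \<alpha> by (simp add: degree_of_exponent)
    then show ?thesis by (cases \<alpha>) (simp add: moments_def \<alpha>)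
  next
    case False
    then show ?thesis using assms(1,2) by (simp add: forms_iff)
  qed
qed

lemma scale_in_forms: "p \<in> forms d \<Longrightarrow> scale c p \<in> forms d"
  by (simp add: forms_iff lookup_scale)

lemma sum_in_forms: "(\<And>i. i \<in> I \<Longrightarrow> p i \<in> forms d) \<Longrightarrow> (\<Sum>i\<in>I. p i) \<in> forms d"
  by (simp add: forms_iff lookup_sum)

lemma linear_form_in_forms: "linear_form p \<in> forms 1"
  by (cases p)
     (auto simp: forms_iff linear_form_def lookup_add lookup_single when_def degree_of_exponent exponents_def)

lemma exponent_single:
  "exponent (1, 0, 0) = Poly_Mapping.single 1 1" "exponent (0, 1, 0) = Poly_Mapping.single 2 1"
  "exponent (0, 0, 1) = Poly_Mapping.single 3 1"
  by (simp_all add: exponent_def)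

lemma var_coeff_exponent:
  "var_coeff l 1 = Poly_Mapping.lookup l (exponent (1, 0, 0))"
  "var_coeff l 2 = Poly_Mapping.lookup l (exponent (0, 1, 0))"
  "var_coeff l 3 = Poly_Mapping.lookup l (exponent (0, 0, 1))"
  unfolding var_coeff_def exponent_single by (rule refl)+

lemma point_linear_form: "point (linear_form p) = p"
  by (cases p) (simp add: point_def var_coeff_exponent linear_form_def lookup_add lookup_single when_def
      exponent_eq_iff)

lemma linear_form_point: "l \<in> forms 1 \<Longrightarrow> linear_form (point l) = l"
  by (subst (2) linear_form_eq) (simp_all only: linear_form_def point_def exponent_single sum_3 prod.case)

lemma point_eq_0_iff: "l \<in> forms 1 \<Longrightarrow> point l = (0, 0, 0) \<longleftrightarrow> l = 0"
  using linear_form_point[of l] by (auto simp: linear_form_def point_def var_coeff_def)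

text \<open>Used to normalise the first coordinate of a linear form to 1, at the expense of the
  factor \<open>x ^ d\<close> in the coefficient.\<close>

lemma scale_power_linear_form:
  "scale c (linear_form (x * p, x * q, x * r) ^ d) = scale (c * x ^ d) (linear_form (p, q, r) ^ d)"
proof -
  have "linear_form (x * p, x * q, x * r) = Poly_Mapping.single 0 x * linear_form (p, q, r)"
    by (simp add: linear_form_def distrib_left mult_single)
  moreover have "(Poly_Mapping.single 0 x :: 3 cpoly) ^ d = Poly_Mapping.single 0 (x ^ d)" for d
    by (induction d) (simp_all add: mult_single)
  moreover have "(Poly_Mapping.single 0 (c * x ^ d) :: 3 cpoly) = Poly_Mapping.single 0 c * Poly_Mapping.single 0 (x ^ d)"
    by (simp add: mult_single)
  ultimately show ?thesis
    by (simp only: scale_def power_mult_distrib mult.assoc)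
qed

lemma polyfun_moments: "polyfun (\<lambda>f. moments (f $ j) \<alpha>)"
  by (cases \<alpha>) (simp only: moments_def prod.case, intro polyfun_mult polyfun_const polyfun_coord)

section \<open>Decompositions\<close>

text \<open>
  If a section vanishes at the points of a decomposition, then its minors annihilate the moments
  of the three forms. Together with a normalisation of the section this gives 15 linear
  equations for its 15 coordinates.
\<close>

definition system_row :: "3 cpoly ^ 3 \<Rightarrow> nat \<Rightarrow> (nat \<Rightarrow> complex) \<Rightarrow> complex"
  where "system_row f r s =
    (if r < 3 then minor r s (moments (f $ 1)) 0 0 0
     else if r < 6 then minor (r - 3) s (moments (f $ 2)) 0 0 0
     else if r < 14 then quartic_minor (r - 6) s (moments (f $ 3))
     else s 3)"

text \<open>Invertibility of the system: the first 14 rows leave at most a line of sections, and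
  their nonzero solutions have \<open>s 3\<close> nonzero.\<close>

definition regular :: "3 cpoly ^ 3 \<Rightarrow> bool"
  where "regular f \<longleftrightarrow> (\<forall>s. (\<forall>r<15. system_row f r s = 0) \<longrightarrow> (\<forall>a<15. s a = 0))"

text \<open>The index set is arbitrary, so that points can be indexed by \<open>{..<7}\<close> or by
  their slopes.\<close>

definition combination_of_evaluations ::
    "3 cpoly ^ 3 \<Rightarrow> 'i set \<Rightarrow> ('i \<Rightarrow> complex ^ 3) \<Rightarrow> ('i \<Rightarrow> complex \<times> complex \<times> complex) \<Rightarrow> bool"
  where "combination_of_evaluations f I c p \<longleftrightarrow>
    (\<forall>\<alpha>\<in>exponents 3. moments (f $ 1) \<alpha> = (\<Sum>i\<in>I. c i $ 1 * eval_at (p i) \<alpha>)) \<and>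
    (\<forall>\<alpha>\<in>exponents 3. moments (f $ 2) \<alpha> = (\<Sum>i\<in>I. c i $ 2 * eval_at (p i) \<alpha>)) \<and>
    (\<forall>\<alpha>\<in>exponents 4. moments (f $ 3) \<alpha> = (\<Sum>i\<in>I. c i $ 3 * eval_at (p i) \<alpha>))"

lemma quartic_minor_expand_section:
  "quartic_minor n s \<phi> = (\<Sum>a<15. quartic_minor n (basis_section a) \<phi> * s a)"
  unfolding quartic_minor_def by (simp flip: minor_expand_section)

lemma system_row_expand: "(\<Sum>a<15. system_row f r (basis_section a) * s a) = system_row f r s"
proof -
  have "(\<Sum>a<15. basis_section a 3 * s a) = s 3" by (simp add: sum_less_15 basis_section_def)
  then show ?thesis
    by (simp add: system_row_def flip: minor_expand_section quartic_minor_expand_section)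
qed

lemma system_row_diff: "system_row f r (\<lambda>a. s a - s' a) = system_row f r s - system_row f r s'"
  by (simp add: system_row_def quartic_minor_def minor_diff_section)

lemma system_row_scale: "system_row f r (\<lambda>a. c * s a) = c * system_row f r s"
  by (simp add: system_row_def quartic_minor_def minor_scale_section)

lemma polyfun_minor: "polyfun (\<lambda>f. minor m s (moments (f $ j)) i k l)"
  unfolding minor_defs
  by (cases "m = 0"; cases "m = 1") (simp_all, (intro polyfun_add polyfun_diff polyfun_mult polyfun_const polyfun_moments)+)

lemma polyfun_system_row: "polyfun (\<lambda>f. system_row f r s)"
  unfolding system_row_def quartic_minor_def
  by (cases "r < 3"; cases "r < 6"; cases "r < 14"; cases "r - 6 < 3"; cases "r - 6 < 6")
     (simp_all add: polyfun_minor polyfun_const)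

text \<open>The minors annihilate the evaluation at each zero, hence every combination of such
  evaluations.\<close>

lemma system_row_eq_0:
  assumes f: "combination_of_evaluations f I c p" and z: "\<And>i. i \<in> I \<Longrightarrow> zero_of s (p i)"
    and r: "r < 14"
  shows "system_row f r s = 0"
proof -
  have cubic: "minor m s \<phi> 0 0 0 = 0"
    if "\<forall>\<alpha>\<in>exponents 3. \<phi> \<alpha> = (\<Sum>i\<in>I. b i * eval_at (p i) \<alpha>)" "m < 3" for m b \<phi>
  proof -
    have "minor m s \<phi> 0 0 0 = minor m s (\<lambda>\<alpha>. \<Sum>i\<in>I. b i * eval_at (p i) \<alpha>) 0 0 0"
      by (rule minor_cong) (use that in simp)
    then show ?thesis using that z by (simp add: minor_sum_functional minor_eval_at_zero)
  qed
  have quartic: "minor m s \<phi> i j k = 0"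
    if "\<forall>\<alpha>\<in>exponents 4. \<phi> \<alpha> = (\<Sum>i\<in>I. b i * eval_at (p i) \<alpha>)" "m < 3" "i + j + k = 1" for m b \<phi> i j k
  proof -
    have "minor m s \<phi> i j k = minor m s (\<lambda>\<alpha>. \<Sum>i\<in>I. b i * eval_at (p i) \<alpha>) i j k"
      by (rule minor_cong) (use that in simp)
    then show ?thesis using that z by (simp add: minor_sum_functional minor_eval_at_zero)
  qed
  show ?thesis
    using f r unfolding combination_of_evaluations_def system_row_def quartic_minor_def
    by (auto intro!: cubic quartic)
qed

lemma decomposition_moments:
  assumes a: "a = vector [3, 3, 4]" and l: "\<And>i. i < k \<Longrightarrow> l i \<in> forms 1"
    and f: "f = (\<Sum>i<k. waring_summand a (c i) (l i))"
  shows "combination_of_evaluations f {..<k} c (\<lambda>i. point (l i))"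
proof -
  have "moments (f $ j) \<alpha> = (\<Sum>i<k. c i $ j * eval_at (point (l i)) \<alpha>)"
    if "\<alpha> \<in> exponents (a $ j)" for j \<alpha>
    using that l by (simp add: f waring_summand_def moments_sum moments_scale moments_power)
  then show ?thesis by (simp add: combination_of_evaluations_def a vector_3 flip: vector_3) (simp add: a)
qed

lemma decomposition_from_moments:
  assumes a: "a = vector [3, 3, 4]" and f: "f \<in> poly_vectors a"
    and l: "\<And>i. i < k \<Longrightarrow> l i \<in> forms 1"
    and m: "combination_of_evaluations f {..<k} c (\<lambda>i. point (l i))"
  shows "f = (\<Sum>i<k. waring_summand a (c i) (l i))"
proof -
  let ?g = "\<Sum>i<k. waring_summand a (c i) (l i)"
  have m': "moments (f $ j) \<alpha> = (\<Sum>i<k. c i $ j * eval_at (point (l i)) \<alpha>)"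
    if "\<alpha> \<in> exponents (a $ j)" for j \<alpha>
    using m that exhaust_3[of j] by (auto simp: combination_of_evaluations_def a)
  have "f $ j = ?g $ j" for j
  proof (rule forms_eqI)
    show "f $ j \<in> forms (a $ j)" using f by (simp add: poly_vectors_def)
    show "?g $ j \<in> forms (a $ j)"
      using l by (auto simp: waring_summand_def intro!: sum_in_forms scale_in_forms power_in_forms)
    fix \<alpha> assume "\<alpha> \<in> exponents (a $ j)"
    then show "moments (f $ j) \<alpha> = moments (?g $ j) \<alpha>"
      using l by (simp add: m' waring_summand_def moments_sum moments_scale moments_power)
  qed
  then show ?thesis by (simp add: vec_eq_iff)
qed

section \<open>Recovering points and coefficients from the section\<close>

text \<open>After subtraction of the multiple of \<open>s\<close> with the same coordinate 3,
  \<open>s'\<close> satisfies the last row too, and vanishes by regularity.\<close>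

lemma regular_section_unique:
  assumes reg: "regular f" and s: "\<And>r. r < 14 \<Longrightarrow> system_row f r s = 0" and s3: "s 3 \<noteq> 0"
    and s': "\<And>r. r < 14 \<Longrightarrow> system_row f r s' = 0" and nz: "\<exists>a<15. s' a \<noteq> 0"
  shows "\<exists>\<kappa>. \<kappa> \<noteq> 0 \<and> (\<forall>a<15. s' a = \<kappa> * s a)"
proof -
  define \<kappa> where "\<kappa> = s' 3 / s 3"
  have "system_row f r (\<lambda>a. s' a - \<kappa> * s a) = 0" if "r < 15" for r
  proof (cases "r < 14")
    case True
    then show ?thesis using s s' by (simp add: system_row_diff system_row_scale)
  next
    case False
    then show ?thesis using s3 that by (simp add: system_row_def \<kappa>_def)
  qed
  then have "\<forall>a<15. s' a - \<kappa> * s a = 0"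
    by (intro mp[OF spec[OF reg[unfolded regular_def], of "\<lambda>a. s' a - \<kappa> * s a"]] allI impI)
  then have eq: "\<forall>a<15. s' a = \<kappa> * s a" by simp
  moreover have "\<kappa> \<noteq> 0" using eq nz by auto
  ultimately show ?thesis by blast
qed

lemma zero_of_proportional:
  assumes "\<kappa> \<noteq> 0" "\<forall>a<15. s' a = \<kappa> * s a" "zero_of s' p"
  shows "zero_of s p"
proof -
  have "minor m s' (eval_at p) 0 0 0 = \<kappa> * minor m s (eval_at p) 0 0 0" for m
    using minor_section_cong[of s' "\<lambda>a. \<kappa> * s a"] assms(2) by (simp add: minor_scale_section)
  then show ?thesis using assms by (simp add: zero_of_def)
qed

text \<open>A nonzero section vanishing at the seven points exists because
  \<open>2 * 7 < 15\<close>. It satisfies the 14 equations, hence is proportional to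
  \<open>s\<close>, and the points are zeros of \<open>s\<close>, determined up to scaling by their
  slopes.\<close>

lemma decomposition_points:
  assumes reg: "regular f" and s: "\<And>r. r < 14 \<Longrightarrow> system_row f r s = 0" "s 3 \<noteq> 0"
    and good: "good_section s"
    and f: "combination_of_evaluations f {..<7::nat} c p" and p: "\<And>i. i < 7 \<Longrightarrow> p i \<noteq> (0, 0, 0)"
  defines "\<tau> \<equiv> \<lambda>i. fst (snd (p i)) / fst (p i)"
  shows "bij_betw \<tau> {..<7} (roots s)"
    and "i < 7 \<Longrightarrow> p i = (fst (p i) * 1, fst (p i) * \<tau> i, fst (p i) * fibre_root s (\<tau> i))"
    and "i < 7 \<Longrightarrow> fst (p i) \<noteq> 0"
proof -
  have "card (p ` {..<7}) \<le> 7" using card_image_le[of "{..<7::nat}" p] by simp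
  moreover have "(0, 0, 0) \<notin> p ` {..<7}" using p by fastforce
  ultimately have "\<exists>s. (\<exists>a<15. s a \<noteq> 0) \<and> (\<forall>q\<in>p ` {..<7}. zero_of s q) \<and> (\<forall>a\<in>{}. s a = 0)"
    by (intro section_vanishing_at) auto
  then obtain s' where s': "\<exists>a<15. s' a \<noteq> 0" "\<forall>q\<in>p ` {..<7}. zero_of s' q" by blast
  have "system_row f r s' = 0" if "r < 14" for r
    using system_row_eq_0[OF f _ that] s' by auto
  from regular_section_unique[OF reg s this s'(1)]
  obtain \<kappa> where "\<kappa> \<noteq> 0" "\<forall>a<15. s' a = \<kappa> * s a" by blast
  then have zero: "zero_of s (p i)" if "i < 7" for i
    using zero_of_proportional s'(2) that by blast
  have pt: "fst (p i) \<noteq> 0" "\<tau> i \<in> roots s"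
    "p i = (fst (p i) * 1, fst (p i) * \<tau> i, fst (p i) * fibre_root s (\<tau> i))" if i: "i < 7" for i
  proof -
    obtain x y z where xyz: "p i = (x, y, z)" by (cases "p i")
    note * = zero_of_good_section[OF good zero[OF i, unfolded xyz] p[OF i, unfolded xyz]]
    show "fst (p i) \<noteq> 0" "\<tau> i \<in> roots s" using * by (simp_all add: xyz \<tau>_def)
    show "p i = (fst (p i) * 1, fst (p i) * \<tau> i, fst (p i) * fibre_root s (\<tau> i))"
      using *(1) *(3)[symmetric] by (simp add: xyz \<tau>_def)
  qed
  show "i < 7 \<Longrightarrow> fst (p i) \<noteq> 0"
    "i < 7 \<Longrightarrow> p i = (fst (p i) * 1, fst (p i) * \<tau> i, fst (p i) * fibre_root s (\<tau> i))"
    using pt by blast+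
  have "card (\<tau> ` {..<7}) = 7"
  proof (rule ccontr)
    assume "card (\<tau> ` {..<7}) \<noteq> 7"
    then have c6: "card (\<tau> ` {..<7}) \<le> 6" using card_image_le[of "{..<7::nat}" \<tau>] by simp
    \<comment> \<open>If slopes coincide, at most six normalised points remain, which leaves room
      for the further condition \<open>s'' 3 = 0\<close>, as \<open>2 * 6 + 1 < 15\<close>. This
      contradicts uniqueness up to scalars, because \<open>s 3\<close> is nonzero.\<close>
    let ?P = "(\<lambda>t. (1 :: complex, t, fibre_root s t)) ` \<tau> ` {..<7}"
    have "card ?P \<le> card (\<tau> ` {..<7})" by (intro card_image_le) auto
    then have "card ?P < 7" using c6 by linarith
    then have "\<exists>s. (\<exists>a<15. s a \<noteq> 0) \<and> (\<forall>q\<in>?P. zero_of s q) \<and> (\<forall>a\<in>{3}. s a = 0)"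
      by (intro section_vanishing_at) auto
    then obtain s'' where s'': "\<exists>a<15. s'' a \<noteq> 0" "\<forall>q\<in>?P. zero_of s'' q" "s'' 3 = 0" by blast
    have "zero_of s'' (p i)" if i: "i < 7" for i
      using s''(2) i by (subst pt(3)[OF i], subst zero_of_scale[OF pt(1)[OF i]]) auto
    then have "system_row f r s'' = 0" if "r < 14" for r
      using system_row_eq_0[OF f _ that] by auto
    from regular_section_unique[OF reg s this s''(1)] s(2) s''(3) show False by auto
  qed
  moreover have "\<tau> ` {..<7} \<subseteq> roots s" using pt by auto
  ultimately have "\<tau> ` {..<7} = roots s"
    using finite_roots[OF good] card_roots[OF good] by (intro card_subset_eq) auto
  moreover have "inj_on \<tau> {..<7}"
    using \<open>card (\<tau> ` {..<7}) = 7\<close> by (intro eq_card_imp_inj_on) auto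
  ultimately show "bij_betw \<tau> {..<7} (roots s)" by (simp add: bij_betw_def)
qed

text \<open>Existence: the equations of \<open>s\<close> force the moments of \<open>f\<close> into
  the span of the evaluations at the zeros of \<open>s\<close>; nonzero components of
  \<open>f\<close> give nonzero scalar vectors. Uniqueness: every decomposition has these zeros as
  its points, and independence of the evaluations fixes its coefficients.\<close>

lemma identifiable_if_regular:
  assumes a: "a = vector [3, 3, 4]" and f: "f \<in> poly_vectors a"
    and reg: "regular f" and s: "\<And>r. r < 14 \<Longrightarrow> system_row f r s = 0" "s 3 \<noteq> 0"
    and good: "good_section s" and nz: "\<And>j. f $ j \<noteq> 0"
  shows "identifiable a 7 f"
proof -
  let ?E = "roots s" and ?P = "\<lambda>t. (1 :: complex, t, fibre_root s t)"
  have E: "finite ?E" "card ?E = 7" using finite_roots[OF good] card_roots[OF good] by auto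
  have r: "res_infinity s \<noteq> 0" using good by (simp add: good_section_def)
  note zero = zero_of_root[OF good]
  have a_simps: "a $ 1 = 3" "a $ 2 = 3" "a $ 3 = 4" by (simp_all add: a)
  have indep: "b t = b' t"
    if "\<forall>\<alpha>\<in>exponents d. (\<Sum>t\<in>?E. b t * eval_at (?P t) \<alpha>) = (\<Sum>t\<in>?E. b' t * eval_at (?P t) \<alpha>)"
      "3 \<le> d" "t \<in> ?E" for b b' d t
  proof -
    have "b t - b' t = 0"
      by (rule evaluations_independent[OF r E(1) _ zero that(2) _ that(3), where c = "\<lambda>t. b t - b' t" and t = "\<lambda>t. t"])
         (use that(1) in \<open>auto simp: left_diff_distrib sum_subtractf\<close>)
    then show ?thesis by simp
  qed
  have "minor m s (moments (f $ 1)) 0 0 0 = 0" "minor m s (moments (f $ 2)) 0 0 0 = 0" if "m < 3" for m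
    using s(1)[of m] s(1)[of "m + 3"] that by (simp_all add: system_row_def)
  note cubic = cubic_spanned[where t = "\<lambda>t. t" and z = "fibre_root s", OF r E inj_on_id2 zero, OF _ this(1)]
    cubic_spanned[where t = "\<lambda>t. t" and z = "fibre_root s", OF r E inj_on_id2 zero, OF _ this(2)]
  have "quartic_minor n s (moments (f $ 3)) = 0" if "n < 8" for n
    using s(1)[of "n + 6"] that by (simp add: system_row_def)
  note quartic = quartic_spanned[where t = "\<lambda>t. t" and z = "fibre_root s", OF r E inj_on_id2 zero, OF _ this]
  have "\<exists>b. \<forall>\<alpha>\<in>exponents 3. moments (f $ 1) \<alpha> = (\<Sum>t\<in>?E. b t * eval_at (?P t) \<alpha>)"
    by (rule cubic(1))
  then obtain b1 where b1:
    "\<forall>\<alpha>\<in>exponents 3. moments (f $ 1) \<alpha> = (\<Sum>t\<in>?E. b1 t * eval_at (?P t) \<alpha>)"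
    by (elim exE)
  have "\<exists>b. \<forall>\<alpha>\<in>exponents 3. moments (f $ 2) \<alpha> = (\<Sum>t\<in>?E. b t * eval_at (?P t) \<alpha>)"
    by (rule cubic(2))
  then obtain b2 where b2:
    "\<forall>\<alpha>\<in>exponents 3. moments (f $ 2) \<alpha> = (\<Sum>t\<in>?E. b2 t * eval_at (?P t) \<alpha>)"
    by (elim exE)
  have "\<exists>b. \<forall>\<alpha>\<in>exponents 4. moments (f $ 3) \<alpha> = (\<Sum>t\<in>?E. b t * eval_at (?P t) \<alpha>)"
    by (rule quartic)
  then obtain b3 where b3:
    "\<forall>\<alpha>\<in>exponents 4. moments (f $ 3) \<alpha> = (\<Sum>t\<in>?E. b3 t * eval_at (?P t) \<alpha>)"
    by (elim exE)
  define b :: "complex \<Rightarrow> complex ^ 3" where "b t = vector [b1 t, b2 t, b3 t]" for t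
  have comb: "combination_of_evaluations f ?E b ?P"
    using b1 b2 b3 by (simp add: combination_of_evaluations_def b_def)
  define S where "S t = waring_summand a (b t) (linear_form (?P t))" for t
  define D where "D = image_mset S (mset_set ?E)"
  have "D \<in> waring_decompositions a 7 f"
  proof -
    obtain g where g: "bij_betw g {..<7::nat} ?E"
      using ex_bij_betw_nat_finite[OF E(1)] E(2) by (auto simp: lessThan_atLeast0)
    have sum_g: "(\<Sum>i<7. h (g i)) = sum h ?E" for h :: "complex \<Rightarrow> complex"
      using sum.reindex_bij_betw[OF g] .
    let ?l = "\<lambda>i. linear_form (?P (g i))" and ?c = "\<lambda>i. b (g i)"
    have comb': "combination_of_evaluations f {..<7} ?c (\<lambda>i. point (?l i))"
      using comb unfolding combination_of_evaluations_def point_linear_form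
      by (simp add: sum_g[of "\<lambda>t. b t $ _ * eval_at (?P t) _"])
    have eq: "f = (\<Sum>i<7. waring_summand a (?c i) (?l i))"
      by (rule decomposition_from_moments[OF a f linear_form_in_forms comb'])
    have "\<exists>i<7. ?c i $ j \<noteq> 0" for j
    proof (rule ccontr)
      assume "\<not> ?thesis"
      then have "f $ j = 0" by (subst eq) (simp add: waring_summand_def scale_def)
      then show False using nz by simp
    qed
    moreover have "?l i \<noteq> 0" for i
      using point_eq_0_iff[OF linear_form_in_forms, of "?P (g i)"] by (simp add: point_linear_form)
    ultimately have "is_waring_decomposition a 7 f ?l ?c"
      using eq linear_form_in_forms by (auto simp: is_waring_decomposition_def)
    moreover have "D = {# waring_summand a (?c i) (?l i). i \<in># mset_set {..<7} #}"
    proof -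
      have "mset_set ?E = image_mset g (mset_set {..<7})"
        using g by (metis bij_betw_def image_mset_mset_set)
      then show ?thesis by (simp add: D_def S_def multiset.map_comp o_def)
    qed
    ultimately show ?thesis unfolding waring_decompositions_def mem_Collect_eq
      by (intro exI[of _ ?l] exI[of _ ?c] conjI)
  qed
  moreover have "D' = D" if D'_in: "D' \<in> waring_decompositions a 7 f" for D'
  proof -
    obtain l c where D': "D' = {# waring_summand a (c i) (l i). i \<in># mset_set {..<7} #}"
      and dec: "is_waring_decomposition a 7 f l c"
      using D'_in unfolding waring_decompositions_def mem_Collect_eq by (elim exE conjE)
    define p where "p i = point (l i)" for i
    have l: "l i \<in> forms 1" "p i \<noteq> (0, 0, 0)" if "i < 7" for i
      using dec that by (auto simp: is_waring_decomposition_def p_def point_eq_0_iff)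
    have cp: "combination_of_evaluations f {..<7} c p"
      unfolding p_def
      by (rule decomposition_moments[OF a]) (use dec in \<open>auto simp: is_waring_decomposition_def\<close>)
    define \<tau> where "\<tau> = (\<lambda>i. fst (snd (p i)) / fst (p i))"
    have bij: "bij_betw \<tau> {..<7} ?E"
      unfolding \<tau>_def by (rule decomposition_points(1)[OF reg s good cp l(2)])
    define x where "x i = fst (p i)" for i
    have pi: "p i = (x i * 1, x i * \<tau> i, x i * fibre_root s (\<tau> i))" if i: "i < 7" for i
      unfolding x_def \<tau>_def by (rule decomposition_points(2)[OF reg s good cp l(2) i])
    define \<sigma> where "\<sigma> = inv_into {..<7} \<tau>"
    have \<sigma>: "\<sigma> (\<tau> i) = i" if "i < 7" for i
      using bij that by (simp add: \<sigma>_def bij_betw_def inv_into_f_f)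
    \<comment> \<open>Both sides are the coefficient of \<open>f $ j\<close> at the normalised point
      of slope \<open>\<tau> i\<close>; the power of \<open>x i\<close> comes from scaling the first
      coordinate to 1.\<close>
    have coef: "c i $ j * x i ^ a $ j = b (\<tau> i) $ j" if i: "i < 7" for i j
    proof -
      let ?b' = "\<lambda>t. c (\<sigma> t) $ j * x (\<sigma> t) ^ a $ j"
      have d: "3 \<le> a $ j" using exhaust_3[of j] by (auto simp: a_simps)
      have ev: "(\<Sum>t\<in>?E. ?b' t * eval_at (?P t) \<alpha>) = (\<Sum>i<7. c i $ j * eval_at (p i) \<alpha>)"
        if \<alpha>: "\<alpha> \<in> exponents (a $ j)" for \<alpha>
      proof -
        have "(\<Sum>t\<in>?E. ?b' t * eval_at (?P t) \<alpha>) = (\<Sum>i<7. ?b' (\<tau> i) * eval_at (?P (\<tau> i)) \<alpha>)"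
          by (rule sum.reindex_bij_betw[OF bij, symmetric])
        also have "\<dots> = (\<Sum>i<7. c i $ j * eval_at (p i) \<alpha>)"
        proof (rule sum.cong[OF refl])
          fix i assume "i \<in> {..<7::nat}"
          then have i: "i < 7" by simp
          obtain u v w where uvw: "\<alpha> = (u, v, w)" by (cases \<alpha>)
          then have "u + v + w = a $ j" using \<alpha> by (simp add: exponents_def)
          then show "?b' (\<tau> i) * eval_at (?P (\<tau> i)) \<alpha> = c i $ j * eval_at (p i) \<alpha>"
            unfolding uvw by (subst pi[OF i], subst eval_at_scale) (simp add: \<sigma>[OF i])
        qed
        finally show ?thesis .
      qed
      have "b (\<tau> i) $ j = ?b' (\<tau> i)"
      proof (rule indep[where b = "\<lambda>t. b t $ j" and b' = ?b' and t = "\<tau> i", OF _ d])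
        show "\<tau> i \<in> ?E" using bij i by (auto simp: bij_betw_def)
        show "\<forall>\<alpha>\<in>exponents (a $ j). (\<Sum>t\<in>?E. b t $ j * eval_at (?P t) \<alpha>) = (\<Sum>t\<in>?E. ?b' t * eval_at (?P t) \<alpha>)"
          using comb cp exhaust_3[of j] unfolding combination_of_evaluations_def
          by (auto simp: ev) (simp_all add: a_simps)
      qed
      then show ?thesis by (simp add: \<sigma>[OF i])
    qed
    have "waring_summand a (c i) (l i) = S (\<tau> i)" if i: "i < 7" for i
    proof -
      have "l i = linear_form (x i * 1, x i * \<tau> i, x i * fibre_root s (\<tau> i))"
        using linear_form_point[OF l(1)[OF i]] pi[OF i] by (simp add: p_def)
      then show ?thesis
        by (simp only: S_def waring_summand_def vec_eq_iff vec_lambda_beta scale_power_linear_form coef[OF i] simp_thms)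
    qed
    then have "D' = image_mset (\<lambda>i. S (\<tau> i)) (mset_set {..<7})"
      unfolding D' by (intro image_mset_cong) auto
    also have "\<dots> = image_mset S (image_mset \<tau> (mset_set {..<7}))"
      by (simp add: multiset.map_comp o_def)
    also have "image_mset \<tau> (mset_set {..<7}) = mset_set ?E"
      using bij by (metis bij_betw_def image_mset_mset_set)
    finally show ?thesis by (simp add: D_def)
  qed
  ultimately show ?thesis unfolding identifiable_def by blast
qed

section \<open>A witness\<close>

text \<open>
  The witness is chosen such that its section is \<open>(y\<^sup>2, z\<^sup>2, x\<^sup>2)\<close>. This section vanishes at the
  seven points \<open>(1, t, t\<^sup>-\<^sup>2)\<close> with \<open>t\<^sup>7 = 1\<close>.
\<close>

definition witness :: "3 cpoly ^ 3"
  where "witness = vector [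
    Poly_Mapping.single (exponent (1, 2, 0)) 3,
    Poly_Mapping.single (exponent (0, 3, 0)) 1 + Poly_Mapping.single (exponent (1, 0, 2)) 3
      + Poly_Mapping.single (exponent (1, 1, 1)) 6,
    Poly_Mapping.single (exponent (0, 2, 2)) 6 + Poly_Mapping.single (exponent (3, 0, 1)) 4]"

text \<open>Coordinates 3, 11 and 12 belong to \<open>y^2\<close> in \<open>q\<^sub>0\<close>,
  \<open>z^2\<close> in \<open>q\<^sub>1\<close> and \<open>x^2\<close> in
  \<open>q\<^sub>2\<close>.\<close>

definition witness_section :: "nat \<Rightarrow> complex"
  where "witness_section a = (if a \<in> {3, 11, 12} then 1 else 0)"

text \<open>The coefficients in \<open>witness\<close> are the multinomial coefficients of their
  monomials, which makes the moments 0 or 1.\<close>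

lemma moments_witness:
  "moments (witness $ 1) = (\<lambda>\<alpha>. if \<alpha> = (1, 2, 0) then 1 else 0)"
  "moments (witness $ 2) = (\<lambda>\<alpha>. if \<alpha> = (0, 3, 0) \<or> \<alpha> = (1, 0, 2) \<or> \<alpha> = (1, 1, 1) then 1 else 0)"
  "moments (witness $ 3) = (\<lambda>\<alpha>. if \<alpha> = (0, 2, 2) \<or> \<alpha> = (3, 0, 1) then 1 else 0)"
  by (auto simp: fun_eq_iff moments_def witness_def lookup_add lookup_single when_def exponent_eq_iff fact_numeral
      eval_nat_numeral)

lemma witness_in_poly_vectors:
  assumes "a = vector [3, 3, 4]"
  shows "witness \<in> poly_vectors a"
proof -
  have "Poly_Mapping.single (exponent \<alpha>) c \<in> forms d" if "\<alpha> \<in> exponents d" for \<alpha> c d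
    using that by (auto simp: forms_iff lookup_single when_def simp flip: degree_of_exponent)
  moreover have "p + q \<in> forms d" if "p \<in> forms d" "q \<in> forms d" for p q :: "3 cpoly" and d
    using that by (simp add: forms_iff lookup_add)
  ultimately show ?thesis
    unfolding poly_vectors_def forall_3 mem_Collect_eq witness_def assms vector_3
    by (simp add: exponents_def)
qed

lemma all_less_15:
  "(\<forall>r<15. P r) \<longleftrightarrow> P 0 \<and> P 1 \<and> P 2 \<and> P 3 \<and> P 4 \<and> P 5 \<and> P 6 \<and> P 7 \<and> P 8 \<and> P 9 \<and> P 10 \<and> P 11
    \<and> P 12 \<and> P 13 \<and> P (14::nat)"
  by (simp add: All_less_Suc eval_nat_numeral) blast

lemma witness_rows:
  "system_row witness 0 s = s 13" "system_row witness 1 s = - s 14" "system_row witness 2 s = s 9 - s 1"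
  "system_row witness 3 s = s 14 - s 8 - s 7" "system_row witness 4 s = s 1 + s 2"
  "system_row witness 5 s = s 10 + s 11 - s 2 - s 3" "system_row witness 6 s = - s 6"
  "system_row witness 7 s = s 0" "system_row witness 8 s = s 8" "system_row witness 9 s = - s 10"
  "system_row witness 10 s = s 4" "system_row witness 11 s = - s 5" "system_row witness 12 s = - s 9"
  "system_row witness 13 s = s 3 - s 12" "system_row witness 14 s = s 3"
  by (simp_all add: system_row_def quartic_minor_def minor_defs moments_witness)

lemma regular_witness: "regular witness"
  unfolding regular_def all_less_15 witness_rows by (intro allI impI, elim conjE) simp

lemma witness_section_rows: "r < 14 \<Longrightarrow> system_row witness r witness_section = 0"
proof -
  have "\<forall>r<15. r < 14 \<longrightarrow> system_row witness r witness_section = 0"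
    unfolding all_less_15 witness_rows by (simp add: witness_section_def)
  then show "r < 14 \<Longrightarrow> ?thesis" by simp
qed

text \<open>The factor \<open>\<kappa>\<close> is kept because elimination yields the section only
  up to a scalar. Over the slope \<open>t\<close> the two polynomials are
  \<open>\<kappa> (z^2 - t^3)\<close> and \<open>\<kappa> (t^2 z - 1)\<close>, and the eliminant is
  \<open>\<kappa>^5 (1 - t^7)\<close>.\<close>

lemma
  assumes "\<forall>a<15. s a = \<kappa> * witness_section a"
  shows eliminant_witness: "eliminant s = monom (- (\<kappa> ^ 5)) 7 + monom (\<kappa> ^ 5) 0"
    and subeliminant_witness: "subeliminant s = monom (\<kappa> ^ 3) 2"
    and res_infinity_witness: "res_infinity s = \<kappa> ^ 5"
proof -
  note v = assms[unfolded all_less_15 witness_section_def, simplified]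
  have f: "quad2 s = monom \<kappa> 0" "quad1 s = 0" "quad0 s = monom (- \<kappa>) 3" "cub3 s = 0" "cub2 s = 0"
    "cub1 s = monom \<kappa> 2" "cub0 s = monom (- \<kappa>) 0"
    by (simp_all only: fibre_defs v One_nat_def) (simp_all add: monom_altdef numeral_eq_Suc)
  show "eliminant s = monom (- (\<kappa> ^ 5)) 7 + monom (\<kappa> ^ 5) 0"
    unfolding eliminant_def res23_def f by (simp add: mult_monom eval_nat_numeral mult.assoc)
  show "subeliminant s = monom (\<kappa> ^ 3) 2"
    unfolding subeliminant_def subres1_def f by (simp add: mult_monom eval_nat_numeral)
  show "res_infinity s = \<kappa> ^ 5"
    unfolding res_infinity_def res23_def by (simp add: v) (simp add: eval_nat_numeral mult.assoc)
qed

lemma polyfun_coeffs_fibre: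
  assumes "\<And>a. a < 15 \<Longrightarrow> polyfun (\<lambda>f. s f a)"
  shows "polyfun_coeffs (\<lambda>f. eliminant (s f))" "polyfun_coeffs (\<lambda>f. subeliminant (s f))"
    "polyfun (\<lambda>f. res_infinity (s f))"
proof -
  have "polyfun (\<lambda>f. s f 0)" "polyfun (\<lambda>f. s f 1)" "polyfun (\<lambda>f. s f 2)" "polyfun (\<lambda>f. s f 3)"
    "polyfun (\<lambda>f. s f 4)" "polyfun (\<lambda>f. s f 5)" "polyfun (\<lambda>f. s f 6)" "polyfun (\<lambda>f. s f 7)"
    "polyfun (\<lambda>f. s f 8)" "polyfun (\<lambda>f. s f 9)" "polyfun (\<lambda>f. s f 10)" "polyfun (\<lambda>f. s f 11)"
    "polyfun (\<lambda>f. s f 12)" "polyfun (\<lambda>f. s f 13)" "polyfun (\<lambda>f. s f 14)"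
    using assms by simp_all
  note s = this
  have "polyfun_coeffs (\<lambda>f. quad2 (s f))" "polyfun_coeffs (\<lambda>f. quad1 (s f))" "polyfun_coeffs (\<lambda>f. quad0 (s f))"
    "polyfun_coeffs (\<lambda>f. cub3 (s f))" "polyfun_coeffs (\<lambda>f. cub2 (s f))" "polyfun_coeffs (\<lambda>f. cub1 (s f))"
    "polyfun_coeffs (\<lambda>f. cub0 (s f))"
    unfolding fibre_defs
    by (intro polyfun_coeffs_pCons polyfun_coeffs_const polyfun_diff polyfun_uminus s)+
  note p = this
  show "polyfun_coeffs (\<lambda>f. eliminant (s f))"
    unfolding eliminant_def res23_def
    by (intro polyfun_coeffs_add polyfun_coeffs_diff polyfun_coeffs_mult polyfun_coeffs_const p)
  show "polyfun_coeffs (\<lambda>f. subeliminant (s f))"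
    unfolding subeliminant_def subres1_def
    by (intro polyfun_coeffs_add polyfun_coeffs_diff polyfun_coeffs_mult p)
  show "polyfun (\<lambda>f. res_infinity (s f))"
    unfolding res_infinity_def res23_def
    by (intro polyfun_add polyfun_diff polyfun_mult polyfun_const polyfun_uminus s)
qed

theorem theorem1p4:
  fixes a :: "nat ^ 3"
  assumes "a = vector [3, 3, 4]"
  shows "holds_for_general (poly_vectors a :: (3 cpoly ^ 3) set) (identifiable a 7)"
proof -
  \<comment> \<open>The right-hand side is nonzero only in the normalising row 14, so
    \<open>s f\<close> solves the first 14 equations, has coordinate 3 equal to
    \<open>\<Delta> f\<close>, and depends polynomially on \<open>f\<close>.\<close>
  have "\<exists>\<Delta> s. polyfun \<Delta> \<and> (\<forall>j\<in>{..<15}. polyfun (\<lambda>f. s f j)) \<and> \<Delta> witness \<noteq> 0 \<and>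
      (\<forall>f. \<forall>r\<in>{..<15}. (\<Sum>j<15. system_row f r (basis_section j) * s f j) = \<Delta> f * (if r = 14 then 1 else 0)) \<and>
      (\<forall>f. \<Delta> f \<noteq> 0 \<longrightarrow> (\<forall>x. (\<forall>r\<in>{..<15}. (\<Sum>j<15. system_row f r (basis_section j) * x j) = 0) \<longrightarrow>
        (\<forall>j\<in>{..<15}. x j = 0)))"
  proof (rule generic_linear_system)
    fix x :: "nat \<Rightarrow> complex"
    assume "\<forall>r\<in>{..<15}. (\<Sum>j<15. system_row witness r (basis_section j) * x j) = 0"
    then have "\<forall>r<15. system_row witness r x = 0" by (simp add: system_row_expand)
    then show "\<forall>j\<in>{..<15}. x j = 0" using regular_witness unfolding regular_def by simp
  qed (auto intro: polyfun_system_row)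
  then obtain \<Delta> s where *: "polyfun \<Delta> \<and> (\<forall>j\<in>{..<15}. polyfun (\<lambda>f. s f j)) \<and> \<Delta> witness \<noteq> 0 \<and>
      (\<forall>f. \<forall>r\<in>{..<15}. (\<Sum>j<15. system_row f r (basis_section j) * s f j) = \<Delta> f * (if r = 14 then 1 else 0)) \<and>
      (\<forall>f. \<Delta> f \<noteq> 0 \<longrightarrow> (\<forall>x. (\<forall>r\<in>{..<15}. (\<Sum>j<15. system_row f r (basis_section j) * x j) = 0) \<longrightarrow>
        (\<forall>j\<in>{..<15}. x j = 0)))"
    by (elim exE)
  from * have \<Delta>: "polyfun \<Delta>" "\<Delta> witness \<noteq> 0" by auto
  from * have ps: "polyfun (\<lambda>f. s f j)" if "j < 15" for j using that by auto
  from * have rows: "\<forall>f. \<forall>r<15. system_row f r (s f) = \<Delta> f * (if r = 14 then 1 else 0)"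
    unfolding system_row_expand by auto
  have reg: "regular f" if "\<Delta> f \<noteq> 0" for f
    using * that unfolding system_row_expand regular_def by auto
  have rows_s: "system_row f r (s f) = 0" if "r < 14" for f r using rows that by auto
  have s3: "s f 3 = \<Delta> f" for f
  proof -
    have "system_row f 14 (s f) = \<Delta> f" using rows by auto
    then show ?thesis by (simp add: system_row_def)
  qed
  \<comment> \<open>At the witness the eliminated solution is only known to be a nonzero multiple of
    \<open>witness_section\<close>.\<close>
  obtain \<kappa> where \<kappa>: "\<kappa> \<noteq> 0" "\<forall>a<15. s witness a = \<kappa> * witness_section a"
  proof -
    have "\<exists>a<15. s witness a \<noteq> 0" using \<Delta>(2) by (intro exI[of _ 3]) (simp add: s3)
    then have "\<exists>\<kappa>. \<kappa> \<noteq> 0 \<and> (\<forall>a<15. s witness a = \<kappa> * witness_section a)"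
      by (intro regular_section_unique[OF regular_witness witness_section_rows _ rows_s])
         (simp_all add: witness_section_def)
    then show ?thesis using that by blast
  qed
  define F where "F f = eliminant (s f)" for f
  define G where "G f = pderiv (eliminant (s f)) * subeliminant (s f)" for f
  \<comment> \<open>This makes the second half of \<open>good_section\<close> a polynomial condition
    on \<open>f\<close>.\<close>
  have "\<exists>\<Delta>'. polyfun \<Delta>' \<and> \<Delta>' witness \<noteq> 0 \<and>
      (\<forall>f t. \<Delta>' f \<noteq> 0 \<longrightarrow> poly (F f) t = 0 \<longrightarrow> poly (G f) t \<noteq> 0)"
  proof (rule generic_coprime)
    show "polyfun_coeffs F" unfolding F_def[abs_def] using ps by (rule polyfun_coeffs_fibre)
    show "polyfun_coeffs G" unfolding G_def[abs_def]
      using ps by (intro polyfun_coeffs_mult polyfun_coeffs_pderiv polyfun_coeffs_fibre)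
    show "degree (F f) \<le> 7" for f unfolding F_def by (rule degree_eliminant)
    show "degree (G f) \<le> 10" for f
    proof -
      have "degree (G f) \<le> degree (pderiv (eliminant (s f))) + degree (subeliminant (s f))"
        unfolding G_def by (rule degree_mult_le)
      also have "\<dots> \<le> 6 + 4"
        using degree_eliminant[of "s f"] degree_subeliminant[of "s f"] by (intro add_mono) (auto simp: degree_pderiv)
      finally show ?thesis by simp
    qed
    have Fw: "F witness = monom (- (\<kappa> ^ 5)) 7 + monom (\<kappa> ^ 5) 0"
      unfolding F_def by (rule eliminant_witness[OF \<kappa>(2)])
    have Gw: "G witness = monom (- 7 * \<kappa> ^ 8) 8"
      unfolding G_def eliminant_witness[OF \<kappa>(2)] subeliminant_witness[OF \<kappa>(2)]
      by (simp add: pderiv_add pderiv_monom mult_monom distrib_right flip: power_add)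
    have "degree (monom (\<kappa> ^ 5) 0) < degree (monom (- (\<kappa> ^ 5)) 7)"
      using \<kappa>(1) by (simp add: degree_monom_eq)
    then show "degree (F witness) = 7"
      using \<kappa>(1) unfolding Fw by (simp add: degree_add_eq_left degree_monom_eq)
    \<comment> \<open>With \<open>F witness\<close> equal to \<open>\<kappa>^5 (1 - t^7)\<close> and
      \<open>G witness\<close> equal to \<open>- 7 \<kappa>^8 t^8\<close>, this is
      \<open>(1 + t^7) (1 - t^7) + t^14 = 1\<close>.\<close>
    show "(monom (1 / \<kappa> ^ 5) 7 + monom (1 / \<kappa> ^ 5) 0) * F witness + monom (- 1 / (7 * \<kappa> ^ 8)) 6 * G witness = 1"
      using \<kappa>(1) unfolding Fw Gw
      by (simp add: right_diff_distrib distrib_right mult_monom flip: minus_monom)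
  qed simp
  then obtain \<Delta>' where \<Delta>': "polyfun \<Delta>'" "\<Delta>' witness \<noteq> 0"
    and coprime: "\<And>f t. \<Delta>' f \<noteq> 0 \<Longrightarrow> poly (F f) t = 0 \<Longrightarrow> poly (G f) t \<noteq> 0"
    by blast
  \<comment> \<open>One polynomial collects all conditions; the three moments are nonzero at the
    witness and ensure that no component of \<open>f\<close> is zero.\<close>
  define g where "g f = \<Delta> f * \<Delta>' f * res_infinity (s f) * (moments (f $ 1) (1, 2, 0)
      * moments (f $ 2) (0, 3, 0) * moments (f $ 3) (0, 2, 2))" for f
  have "polyfun g" unfolding g_def[abs_def]
    by (intro polyfun_mult \<Delta> \<Delta>' polyfun_moments polyfun_coeffs_fibre ps)
  then have "zariski_open_in (poly_vectors a) {f \<in> poly_vectors a. g f \<noteq> 0}"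
    by (rule zariski_open_in_nonzero)
  moreover have "g witness \<noteq> 0"
    using \<Delta>(2) \<Delta>'(2) \<kappa>(1) by (simp add: g_def moments_witness res_infinity_witness[OF \<kappa>(2)])
  then have "{f \<in> poly_vectors a. g f \<noteq> 0} \<noteq> {}" using witness_in_poly_vectors[OF assms] by auto
  moreover have "identifiable a 7 f" if f: "f \<in> {f \<in> poly_vectors a. g f \<noteq> 0}" for f
  proof (rule identifiable_if_regular[OF assms])
    have nz: "\<Delta> f \<noteq> 0" "\<Delta>' f \<noteq> 0" "res_infinity (s f) \<noteq> 0" "moments (f $ 1) (1, 2, 0) \<noteq> 0"
      "moments (f $ 2) (0, 3, 0) \<noteq> 0" "moments (f $ 3) (0, 2, 2) \<noteq> 0"
      using f by (auto simp: g_def)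
    show "f \<in> poly_vectors a" using f by simp
    show "regular f" using reg nz by blast
    show "system_row f r (s f) = 0" if "r < 14" for r using rows_s that .
    show "s f 3 \<noteq> 0" using nz by (simp add: s3)
    show "good_section (s f)"
      using nz coprime[OF nz(2)] by (simp add: good_section_def F_def G_def)
    show "f $ j \<noteq> 0" for j
      using nz(4-6) exhaust_3[of j] by (auto simp: moments_eq_0_iff)
  qed
  ultimately show ?thesis unfolding holds_for_general_def by blast
qed

end
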